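(* If $\mathit{ID}_1$ proves $\varphi$, then $\mathit{OID}_1$ proves $\hat\varphi$.
   Context: **$\mathit{ID}_1$.** Fix an arithmetic formula $\psi(x,P)$ with at most $x$ free in which the predicate symbol $P$ occurs only positively (no occurrence of $P$ is negated when $\psi$ is in negation-normal form). The corresponding instance of $\mathit{ID}_1$ is classical first-order Peano arithmetic (with symbols and defining axioms for all primitive recursive functions and relations), with an additional predicate $I$, the induction schema on the natural numbers for all formulas of the extended language, and the axioms - $\forall x(\psi(x,I)\to x\in I)$; - $\forall x(\psi(x,\theta/P)\to\theta(x))\to\forall x\in I\;\theta(x)$, for each formula $\theta(x)$ of the language, where $\psi(x,\theta/P)$ is the result of replacing each atomic formula $P(t)$ by $\theta(t)$, renaming bound variables to prevent collisions. **$\mathit{OID}_1$.** The corresponding instance of $\mathit{OID}_1$ is a classical two-sorted theory, with variables $\alpha,\beta,\gamma,\dots$ of sort $\Omega$ (trees) and $i,j,k,n,x,\dots$ of sort $N$. It has symbols for the primitive recursive functions on $N$, a function symbol $\sup^{-1}(\alpha,n)$ with value in $\Omega$, written $\alpha[n]$, equality for terms of type $N$ but not for terms of type $\Omega$, a unary predicate "$\alpha=e$" on $\Omega$, and a binary predicate $I(\alpha,x)$ with $\alpha$ in $\Omega$ and $x$ in $N$, written $x\in I_\alpha$. One writes $x\in I_{\prec\alpha}$ for $\exists i\,(x\in I_{\alpha[i]})$. The axioms are: 1. defining axioms for the primitive recursive functions; 2. induction on $N$ (for all formulas); 3. transfinite induction on $\Omega$ (for all formulas): if $\varphi(\alpha)$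 holds whenever $\alpha=e$, and if $\alpha\ne e\land\forall n\,\varphi(\alpha[n])\to\varphi(\alpha)$ for all $\alpha$, then $\forall\alpha\,\varphi(\alpha)$; 4. $\alpha=e\to\alpha[i]=e$; 5. $\omega$-bounding: $\forall x\,\exists\alpha\,\varphi(x,\alpha)\to\exists\beta\,\forall x\,\exists i\,\varphi(x,\beta[i])$, where $\varphi$ has no quantifiers over type $\Omega$; 6. $\forall x(x\notin I_e)$ (i.e. $\alpha=e\to\forall x(x\notin I_\alpha)$); 7. $\forall\alpha(\alpha\neq e\to\forall x(x\in I_\alpha\leftrightarrow\psi(x,I_{\prec\alpha})))$. **Translation.** For any formula $\varphi$ of $\mathit{ID}_1$, $\hat\varphi$ is the formula obtained by interpreting $t\in I$ as $\exists\alpha\,(t\in I_\alpha)$.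
   Formalization: OID_1 is given one additional axiom, that some tree α satisfies α ≠ e; with axioms 1–7 alone the claim is false: in the model whose only tree is e, all axioms hold but for ψ(x,P) := (x = x) the translation of the ID_1-theorem 0 ∈ I fails. *)

theory Defs
  imports Main
begin

section \<open>Primitive recursive function symbols and numeric terms\<close>

text \<open>
  \<open>Comp n f gs\<close> is the \<open>n\<close>-ary function \<open>x \<mapsto> f (g\<^sub>1 x, \<dots>, g\<^sub>m x)\<close>; the annotation \<open>n\<close> fixes the
  arity when \<open>gs\<close> is empty.  \<open>PRec f g\<close> recurses on its first argument.
\<close>

datatype prsym = Zero | Succ | Proj nat nat | Comp nat prsym "prsym list" | PRec prsym prsym

fun arity :: "prsym \<Rightarrow> nat" where
  "arity Zero = 0"
| "arity Succ = 1"
| "arity (Proj n i) = n"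
| "arity (Comp n f gs) = n"
| "arity (PRec f g) = Suc (arity f)"

fun wf_prsym :: "prsym \<Rightarrow> bool" where
  "wf_prsym Zero = True"
| "wf_prsym Succ = True"
| "wf_prsym (Proj n i) = (i < n)"
| "wf_prsym (Comp n f gs) =
     (wf_prsym f \<and> arity f = length gs \<and> (\<forall>g \<in> set gs. wf_prsym g \<and> arity g = n))"
| "wf_prsym (PRec f g) = (wf_prsym f \<and> wf_prsym g \<and> arity g = Suc (Suc (arity f)))"

text \<open>Variables are de Bruijn indices, here and below.\<close>

datatype trm = Var nat | Fn prsym "trm list"

fun wf_trm :: "trm \<Rightarrow> bool" where
  "wf_trm (Var n) = True"
| "wf_trm (Fn f ts) = (wf_prsym f \<and> length ts = arity f \<and> (\<forall>t \<in> set ts. wf_trm t))"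

fun fv_trm :: "trm \<Rightarrow> nat set" where
  "fv_trm (Var n) = {n}"
| "fv_trm (Fn f ts) = (\<Union>t \<in> set ts. fv_trm t)"

primrec subst_trm :: "(nat \<Rightarrow> trm) \<Rightarrow> trm \<Rightarrow> trm" where
  "subst_trm \<sigma> (Var n) = \<sigma> n"
| "subst_trm \<sigma> (Fn f ts) = Fn f (map (subst_trm \<sigma>) ts)"

abbreviation shift :: "nat \<Rightarrow> trm" where "shift \<equiv> (\<lambda>n. Var (Suc n))"
abbreviation lift_trm :: "trm \<Rightarrow> trm" where "lift_trm \<equiv> subst_trm shift"

definition up :: "(nat \<Rightarrow> trm) \<Rightarrow> nat \<Rightarrow> trm" where
  "up \<sigma> = case_nat (Var 0) (\<lambda>n. lift_trm (\<sigma> n))"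

abbreviation zero :: trm where "zero \<equiv> Fn Zero []"
abbreviation suc :: "trm \<Rightarrow> trm" where "suc t \<equiv> Fn Succ [t]"


section \<open>Formulas of arithmetic with one additional unary predicate\<close>

text \<open>
  \<open>Rel f ts\<close> is the symbol for the primitive recursive relation with characteristic function \<open>f\<close>
  (see \<open>arith_axioms\<close>).  \<open>Pred\<close> plays the role both of the schematic predicate \<open>P\<close> in the operator
  form \<open>\<psi>(x, P)\<close> and of the predicate \<open>I\<close> of \<open>ID\<^sub>1\<close>, so that \<open>\<psi>(x, I)\<close> is \<open>\<psi>\<close> itself.
\<close>

datatype form =
    Eq trm trm
  | Rel prsym "trm list"
  | Pred trm
  | Neg form
  | Con form form
  | Dis form form
  | Imp form form
  | All form
  | Ex form

abbreviation Iff :: "form \<Rightarrow> form \<Rightarrow> form" where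
  "Iff A B \<equiv> Con (Imp A B) (Imp B A)"

primrec wf_form :: "form \<Rightarrow> bool" where
  "wf_form (Eq s t) = (wf_trm s \<and> wf_trm t)"
| "wf_form (Rel f ts) = (wf_prsym f \<and> length ts = arity f \<and> (\<forall>t \<in> set ts. wf_trm t))"
| "wf_form (Pred t) = wf_trm t"
| "wf_form (Neg A) = wf_form A"
| "wf_form (Con A B) = (wf_form A \<and> wf_form B)"
| "wf_form (Dis A B) = (wf_form A \<and> wf_form B)"
| "wf_form (Imp A B) = (wf_form A \<and> wf_form B)"
| "wf_form (All A) = wf_form A"
| "wf_form (Ex A) = wf_form A"

primrec fv :: "form \<Rightarrow> nat set" where
  "fv (Eq s t) = fv_trm s \<union> fv_trm t"
| "fv (Rel f ts) = (\<Union>t \<in> set ts. fv_trm t)"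
| "fv (Pred t) = fv_trm t"
| "fv (Neg A) = fv A"
| "fv (Con A B) = fv A \<union> fv B"
| "fv (Dis A B) = fv A \<union> fv B"
| "fv (Imp A B) = fv A \<union> fv B"
| "fv (All A) = {n. Suc n \<in> fv A}"
| "fv (Ex A) = {n. Suc n \<in> fv A}"

primrec subst :: "(nat \<Rightarrow> trm) \<Rightarrow> form \<Rightarrow> form" where
  "subst \<sigma> (Eq s t) = Eq (subst_trm \<sigma> s) (subst_trm \<sigma> t)"
| "subst \<sigma> (Rel f ts) = Rel f (map (subst_trm \<sigma>) ts)"
| "subst \<sigma> (Pred t) = Pred (subst_trm \<sigma> t)"
| "subst \<sigma> (Neg A) = Neg (subst \<sigma> A)"
| "subst \<sigma> (Con A B) = Con (subst \<sigma> A) (subst \<sigma> B)"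
| "subst \<sigma> (Dis A B) = Dis (subst \<sigma> A) (subst \<sigma> B)"
| "subst \<sigma> (Imp A B) = Imp (subst \<sigma> A) (subst \<sigma> B)"
| "subst \<sigma> (All A) = All (subst (up \<sigma>) A)"
| "subst \<sigma> (Ex A) = Ex (subst (up \<sigma>) A)"

abbreviation lift :: "form \<Rightarrow> form" where "lift \<equiv> subst shift"
abbreviation inst :: "trm \<Rightarrow> form \<Rightarrow> form" where "inst t \<equiv> subst (case_nat t Var)"

text \<open>
  \<open>psubst \<theta> A\<close> replaces \<open>Pred t\<close> in \<open>A\<close> by \<open>\<theta>(t)\<close>.  Index 0 of \<open>\<theta>\<close> is the argument place, index
  \<open>Suc n\<close> of \<open>\<theta>\<close> is the variable \<open>n\<close> of the context of \<open>A\<close>; \<open>lift_param\<close> keeps these parameters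
  from being captured by a binder.
\<close>

abbreviation lift_param :: "form \<Rightarrow> form" where "lift_param \<equiv> subst (up shift)"

primrec psubst :: "form \<Rightarrow> form \<Rightarrow> form" where
  "psubst \<theta> (Eq s t) = Eq s t"
| "psubst \<theta> (Rel f ts) = Rel f ts"
| "psubst \<theta> (Pred t) = inst t \<theta>"
| "psubst \<theta> (Neg A) = Neg (psubst \<theta> A)"
| "psubst \<theta> (Con A B) = Con (psubst \<theta> A) (psubst \<theta> B)"
| "psubst \<theta> (Dis A B) = Dis (psubst \<theta> A) (psubst \<theta> B)"
| "psubst \<theta> (Imp A B) = Imp (psubst \<theta> A) (psubst \<theta> B)"
| "psubst \<theta> (All A) = All (psubst (lift_param \<theta>) A)"
| "psubst \<theta> (Ex A) = Ex (psubst (lift_param \<theta>) A)"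

text \<open>\<open>nnf True A\<close> is the negation-normal form of \<open>A\<close>, \<open>nnf False A\<close> that of \<open>Neg A\<close>.\<close>

primrec nnf :: "bool \<Rightarrow> form \<Rightarrow> form" where
  "nnf b (Eq s t) = (if b then Eq s t else Neg (Eq s t))"
| "nnf b (Rel f ts) = (if b then Rel f ts else Neg (Rel f ts))"
| "nnf b (Pred t) = (if b then Pred t else Neg (Pred t))"
| "nnf b (Neg A) = nnf (\<not> b) A"
| "nnf b (Con A B) = (if b then Con else Dis) (nnf b A) (nnf b B)"
| "nnf b (Dis A B) = (if b then Dis else Con) (nnf b A) (nnf b B)"
| "nnf b (Imp A B) = (if b then Dis else Con) (nnf (\<not> b) A) (nnf b B)"
| "nnf b (All A) = (if b then All else Ex) (nnf b A)"
| "nnf b (Ex A) = (if b then Ex else All) (nnf b A)"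

primrec subformulas :: "form \<Rightarrow> form set" where
  "subformulas (Eq s t) = {Eq s t}"
| "subformulas (Rel f ts) = {Rel f ts}"
| "subformulas (Pred t) = {Pred t}"
| "subformulas (Neg A) = insert (Neg A) (subformulas A)"
| "subformulas (Con A B) = insert (Con A B) (subformulas A \<union> subformulas B)"
| "subformulas (Dis A B) = insert (Dis A B) (subformulas A \<union> subformulas B)"
| "subformulas (Imp A B) = insert (Imp A B) (subformulas A \<union> subformulas B)"
| "subformulas (All A) = insert (All A) (subformulas A)"
| "subformulas (Ex A) = insert (Ex A) (subformulas A)"

definition positive :: "form \<Rightarrow> bool" where
  "positive A \<longleftrightarrow> (\<forall>t. Neg (Pred t) \<notin> subformulas (nnf True A))"


section \<open>Classical one-sorted first-order logic with equality\<close>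

text \<open>
  Natural deduction from a set \<open>T\<close> of axioms and a list of hypotheses.  Free variables of axioms are
  understood as universally quantified, so \<open>T\<close> is not lifted in the quantifier rules.  The
  well-formedness premises ensure that only well-formed formulas occur in derivations.
\<close>

inductive derives :: "form set \<Rightarrow> form list \<Rightarrow> form \<Rightarrow> bool" for T :: "form set" where
  Ax: "A \<in> T \<Longrightarrow> wf_form A \<Longrightarrow> \<forall>B \<in> set \<Gamma>. wf_form B \<Longrightarrow> derives T \<Gamma> A"
| Hyp: "A \<in> set \<Gamma> \<Longrightarrow> \<forall>B \<in> set \<Gamma>. wf_form B \<Longrightarrow> derives T \<Gamma> A"
| NegI: "derives T (A # \<Gamma>) B \<Longrightarrow> derives T (A # \<Gamma>) (Neg B) \<Longrightarrow> derives T \<Gamma> (Neg A)"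
| Classical: "derives T (Neg A # \<Gamma>) B \<Longrightarrow> derives T (Neg A # \<Gamma>) (Neg B) \<Longrightarrow> derives T \<Gamma> A"
| ConI: "derives T \<Gamma> A \<Longrightarrow> derives T \<Gamma> B \<Longrightarrow> derives T \<Gamma> (Con A B)"
| ConE1: "derives T \<Gamma> (Con A B) \<Longrightarrow> derives T \<Gamma> A"
| ConE2: "derives T \<Gamma> (Con A B) \<Longrightarrow> derives T \<Gamma> B"
| DisI1: "derives T \<Gamma> A \<Longrightarrow> wf_form B \<Longrightarrow> derives T \<Gamma> (Dis A B)"
| DisI2: "derives T \<Gamma> B \<Longrightarrow> wf_form A \<Longrightarrow> derives T \<Gamma> (Dis A B)"
| DisE: "derives T \<Gamma> (Dis A B) \<Longrightarrow> derives T (A # \<Gamma>) C \<Longrightarrow> derives T (B # \<Gamma>) C \<Longrightarrow> derives T \<Gamma> C"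
| ImpI: "derives T (A # \<Gamma>) B \<Longrightarrow> derives T \<Gamma> (Imp A B)"
| ImpE: "derives T \<Gamma> (Imp A B) \<Longrightarrow> derives T \<Gamma> A \<Longrightarrow> derives T \<Gamma> B"
| AllI: "derives T (map lift \<Gamma>) A \<Longrightarrow> derives T \<Gamma> (All A)"
| AllE: "derives T \<Gamma> (All A) \<Longrightarrow> wf_trm t \<Longrightarrow> derives T \<Gamma> (inst t A)"
| ExI: "derives T \<Gamma> (inst t A) \<Longrightarrow> wf_trm t \<Longrightarrow> wf_form A \<Longrightarrow> derives T \<Gamma> (Ex A)"
| ExE: "derives T \<Gamma> (Ex A) \<Longrightarrow> derives T (A # map lift \<Gamma>) (lift C) \<Longrightarrow> wf_form C \<Longrightarrow> derives T \<Gamma> C"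
| EqRefl: "wf_trm t \<Longrightarrow> \<forall>B \<in> set \<Gamma>. wf_form B \<Longrightarrow> derives T \<Gamma> (Eq t t)"
| EqSubst: "derives T \<Gamma> (Eq s t) \<Longrightarrow> derives T \<Gamma> (inst s A) \<Longrightarrow> wf_form A \<Longrightarrow> derives T \<Gamma> (inst t A)"


section \<open>The theory \<open>ID\<^sub>1\<close>\<close>

definition vars :: "nat \<Rightarrow> nat \<Rightarrow> trm list" where
  "vars m n = map Var [m..<m + n]"

inductive_set arith_axioms :: "form set" where
  succ_nonzero: "Neg (Eq (suc (Var 0)) zero) \<in> arith_axioms"
| succ_inj: "Imp (Eq (suc (Var 0)) (suc (Var 1))) (Eq (Var 0) (Var 1)) \<in> arith_axioms"
| proj: "wf_prsym (Proj n i) \<Longrightarrow> Eq (Fn (Proj n i) (vars 0 n)) (Var i) \<in> arith_axioms"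
| comp: "wf_prsym (Comp n f gs) \<Longrightarrow>
    Eq (Fn (Comp n f gs) (vars 0 n)) (Fn f (map (\<lambda>g. Fn g (vars 0 n)) gs)) \<in> arith_axioms"
| prec_zero: "wf_prsym (PRec f g) \<Longrightarrow>
    Eq (Fn (PRec f g) (zero # vars 0 (arity f))) (Fn f (vars 0 (arity f))) \<in> arith_axioms"
| prec_succ: "wf_prsym (PRec f g) \<Longrightarrow>
    Eq (Fn (PRec f g) (suc (Var 0) # vars 1 (arity f)))
       (Fn g (Var 0 # Fn (PRec f g) (Var 0 # vars 1 (arity f)) # vars 1 (arity f)))
    \<in> arith_axioms"
| rel: "wf_prsym f \<Longrightarrow>
    Iff (Rel f (vars 0 (arity f))) (Eq (Fn f (vars 0 (arity f))) (suc zero)) \<in> arith_axioms"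

inductive_set id1_axioms :: "form \<Rightarrow> form set" for \<psi> :: form where
  arith: "A \<in> arith_axioms \<Longrightarrow> A \<in> id1_axioms \<psi>"
| induction: "wf_form A \<Longrightarrow>
    Imp (Con (inst zero A) (All (Imp A (subst (case_nat (suc (Var 0)) shift) A)))) (All A)
    \<in> id1_axioms \<psi>"
| closure: "All (Imp \<psi> (Pred (Var 0))) \<in> id1_axioms \<psi>"
| least: "wf_form \<theta> \<Longrightarrow>
    Imp (All (Imp (psubst (lift_param \<theta>) \<psi>) \<theta>)) (All (Imp (Pred (Var 0)) \<theta>)) \<in> id1_axioms \<psi>"

definition id1_proves :: "form \<Rightarrow> form \<Rightarrow> bool" where
  "id1_proves \<psi> \<phi> \<longleftrightarrow> derives (id1_axioms \<psi>) [] \<phi>"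


section \<open>The two-sorted language of \<open>OID\<^sub>1\<close>\<close>

text \<open>
  The two sorts have independent de Bruijn indices.  No function symbol maps trees to numbers, so the
  numeric terms are those of \<open>ID\<^sub>1\<close>.  \<open>Sub \<alpha> t\<close> is \<open>\<alpha>[t]\<close>, \<open>IsE \<alpha>\<close> is \<open>\<alpha> = e\<close>, and \<open>In \<alpha> t\<close> is
  \<open>t \<in> I\<^sub>\<alpha>\<close>.
\<close>

datatype otrm = OVar nat | Sub otrm trm

primrec wf_otrm :: "otrm \<Rightarrow> bool" where
  "wf_otrm (OVar n) = True"
| "wf_otrm (Sub a t) = (wf_otrm a \<and> wf_trm t)"

primrec subst_otrm :: "(nat \<Rightarrow> trm) \<Rightarrow> (nat \<Rightarrow> otrm) \<Rightarrow> otrm \<Rightarrow> otrm" where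
  "subst_otrm \<sigma> \<tau> (OVar n) = \<tau> n"
| "subst_otrm \<sigma> \<tau> (Sub a t) = Sub (subst_otrm \<sigma> \<tau> a) (subst_trm \<sigma> t)"

abbreviation oshift :: "nat \<Rightarrow> otrm" where "oshift \<equiv> (\<lambda>n. OVar (Suc n))"

definition oup :: "(nat \<Rightarrow> otrm) \<Rightarrow> nat \<Rightarrow> otrm" where
  "oup \<tau> = case_nat (OVar 0) (\<lambda>n. subst_otrm Var oshift (\<tau> n))"

definition nup :: "(nat \<Rightarrow> otrm) \<Rightarrow> nat \<Rightarrow> otrm" where
  "nup \<tau> = (\<lambda>n. subst_otrm shift OVar (\<tau> n))"

datatype oform =
    OEq trm trm
  | ORel prsym "trm list"
  | IsE otrm
  | In otrm trm
  | ONeg oform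
  | OCon oform oform
  | ODis oform oform
  | OImp oform oform
  | AllN oform
  | ExN oform
  | AllO oform
  | ExO oform

abbreviation OIff :: "oform \<Rightarrow> oform \<Rightarrow> oform" where
  "OIff A B \<equiv> OCon (OImp A B) (OImp B A)"

primrec wf_oform :: "oform \<Rightarrow> bool" where
  "wf_oform (OEq s t) = (wf_trm s \<and> wf_trm t)"
| "wf_oform (ORel f ts) = (wf_prsym f \<and> length ts = arity f \<and> (\<forall>t \<in> set ts. wf_trm t))"
| "wf_oform (IsE a) = wf_otrm a"
| "wf_oform (In a t) = (wf_otrm a \<and> wf_trm t)"
| "wf_oform (ONeg A) = wf_oform A"
| "wf_oform (OCon A B) = (wf_oform A \<and> wf_oform B)"
| "wf_oform (ODis A B) = (wf_oform A \<and> wf_oform B)"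
| "wf_oform (OImp A B) = (wf_oform A \<and> wf_oform B)"
| "wf_oform (AllN A) = wf_oform A"
| "wf_oform (ExN A) = wf_oform A"
| "wf_oform (AllO A) = wf_oform A"
| "wf_oform (ExO A) = wf_oform A"

primrec osubst :: "(nat \<Rightarrow> trm) \<Rightarrow> (nat \<Rightarrow> otrm) \<Rightarrow> oform \<Rightarrow> oform" where
  "osubst \<sigma> \<tau> (OEq s t) = OEq (subst_trm \<sigma> s) (subst_trm \<sigma> t)"
| "osubst \<sigma> \<tau> (ORel f ts) = ORel f (map (subst_trm \<sigma>) ts)"
| "osubst \<sigma> \<tau> (IsE a) = IsE (subst_otrm \<sigma> \<tau> a)"
| "osubst \<sigma> \<tau> (In a t) = In (subst_otrm \<sigma> \<tau> a) (subst_trm \<sigma> t)"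
| "osubst \<sigma> \<tau> (ONeg A) = ONeg (osubst \<sigma> \<tau> A)"
| "osubst \<sigma> \<tau> (OCon A B) = OCon (osubst \<sigma> \<tau> A) (osubst \<sigma> \<tau> B)"
| "osubst \<sigma> \<tau> (ODis A B) = ODis (osubst \<sigma> \<tau> A) (osubst \<sigma> \<tau> B)"
| "osubst \<sigma> \<tau> (OImp A B) = OImp (osubst \<sigma> \<tau> A) (osubst \<sigma> \<tau> B)"
| "osubst \<sigma> \<tau> (AllN A) = AllN (osubst (up \<sigma>) (nup \<tau>) A)"
| "osubst \<sigma> \<tau> (ExN A) = ExN (osubst (up \<sigma>) (nup \<tau>) A)"
| "osubst \<sigma> \<tau> (AllO A) = AllO (osubst \<sigma> (oup \<tau>) A)"
| "osubst \<sigma> \<tau> (ExO A) = ExO (osubst \<sigma> (oup \<tau>) A)"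

abbreviation lift_N :: "oform \<Rightarrow> oform" where "lift_N \<equiv> osubst shift OVar"
abbreviation lift_O :: "oform \<Rightarrow> oform" where "lift_O \<equiv> osubst Var oshift"
abbreviation inst_N :: "trm \<Rightarrow> oform \<Rightarrow> oform" where "inst_N t \<equiv> osubst (case_nat t Var) OVar"
abbreviation inst_O :: "otrm \<Rightarrow> oform \<Rightarrow> oform" where "inst_O a \<equiv> osubst Var (case_nat a OVar)"

primrec no_tree_quant :: "oform \<Rightarrow> bool" where
  "no_tree_quant (OEq s t) = True"
| "no_tree_quant (ORel f ts) = True"
| "no_tree_quant (IsE a) = True"
| "no_tree_quant (In a t) = True"
| "no_tree_quant (ONeg A) = no_tree_quant A"
| "no_tree_quant (OCon A B) = (no_tree_quant A \<and> no_tree_quant B)"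
| "no_tree_quant (ODis A B) = (no_tree_quant A \<and> no_tree_quant B)"
| "no_tree_quant (OImp A B) = (no_tree_quant A \<and> no_tree_quant B)"
| "no_tree_quant (AllN A) = no_tree_quant A"
| "no_tree_quant (ExN A) = no_tree_quant A"
| "no_tree_quant (AllO A) = False"
| "no_tree_quant (ExO A) = False"

text \<open>
  Classical two-sorted logic.  Equality exists only between numeric terms, but equal numeric terms
  may be substituted for each other in every formula, in particular inside \<open>Sub \<alpha> t\<close>.
\<close>

inductive oderives :: "oform set \<Rightarrow> oform list \<Rightarrow> oform \<Rightarrow> bool" for T :: "oform set" where
  Ax: "A \<in> T \<Longrightarrow> wf_oform A \<Longrightarrow> \<forall>B \<in> set \<Gamma>. wf_oform B \<Longrightarrow> oderives T \<Gamma> A"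
| Hyp: "A \<in> set \<Gamma> \<Longrightarrow> \<forall>B \<in> set \<Gamma>. wf_oform B \<Longrightarrow> oderives T \<Gamma> A"
| NegI: "oderives T (A # \<Gamma>) B \<Longrightarrow> oderives T (A # \<Gamma>) (ONeg B) \<Longrightarrow> oderives T \<Gamma> (ONeg A)"
| Classical: "oderives T (ONeg A # \<Gamma>) B \<Longrightarrow> oderives T (ONeg A # \<Gamma>) (ONeg B) \<Longrightarrow> oderives T \<Gamma> A"
| ConI: "oderives T \<Gamma> A \<Longrightarrow> oderives T \<Gamma> B \<Longrightarrow> oderives T \<Gamma> (OCon A B)"
| ConE1: "oderives T \<Gamma> (OCon A B) \<Longrightarrow> oderives T \<Gamma> A"
| ConE2: "oderives T \<Gamma> (OCon A B) \<Longrightarrow> oderives T \<Gamma> B"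
| DisI1: "oderives T \<Gamma> A \<Longrightarrow> wf_oform B \<Longrightarrow> oderives T \<Gamma> (ODis A B)"
| DisI2: "oderives T \<Gamma> B \<Longrightarrow> wf_oform A \<Longrightarrow> oderives T \<Gamma> (ODis A B)"
| DisE: "oderives T \<Gamma> (ODis A B) \<Longrightarrow> oderives T (A # \<Gamma>) C \<Longrightarrow> oderives T (B # \<Gamma>) C \<Longrightarrow>
    oderives T \<Gamma> C"
| ImpI: "oderives T (A # \<Gamma>) B \<Longrightarrow> oderives T \<Gamma> (OImp A B)"
| ImpE: "oderives T \<Gamma> (OImp A B) \<Longrightarrow> oderives T \<Gamma> A \<Longrightarrow> oderives T \<Gamma> B"
| AllNI: "oderives T (map lift_N \<Gamma>) A \<Longrightarrow> oderives T \<Gamma> (AllN A)"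
| AllNE: "oderives T \<Gamma> (AllN A) \<Longrightarrow> wf_trm t \<Longrightarrow> oderives T \<Gamma> (inst_N t A)"
| ExNI: "oderives T \<Gamma> (inst_N t A) \<Longrightarrow> wf_trm t \<Longrightarrow> wf_oform A \<Longrightarrow> oderives T \<Gamma> (ExN A)"
| ExNE: "oderives T \<Gamma> (ExN A) \<Longrightarrow> oderives T (A # map lift_N \<Gamma>) (lift_N C) \<Longrightarrow> wf_oform C \<Longrightarrow>
    oderives T \<Gamma> C"
| AllOI: "oderives T (map lift_O \<Gamma>) A \<Longrightarrow> oderives T \<Gamma> (AllO A)"
| AllOE: "oderives T \<Gamma> (AllO A) \<Longrightarrow> wf_otrm a \<Longrightarrow> oderives T \<Gamma> (inst_O a A)"
| ExOI: "oderives T \<Gamma> (inst_O a A) \<Longrightarrow> wf_otrm a \<Longrightarrow> wf_oform A \<Longrightarrow> oderives T \<Gamma> (ExO A)"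
| ExOE: "oderives T \<Gamma> (ExO A) \<Longrightarrow> oderives T (A # map lift_O \<Gamma>) (lift_O C) \<Longrightarrow> wf_oform C \<Longrightarrow>
    oderives T \<Gamma> C"
| EqRefl: "wf_trm t \<Longrightarrow> \<forall>B \<in> set \<Gamma>. wf_oform B \<Longrightarrow> oderives T \<Gamma> (OEq t t)"
| EqSubst: "oderives T \<Gamma> (OEq s t) \<Longrightarrow> oderives T \<Gamma> (inst_N s A) \<Longrightarrow> wf_oform A \<Longrightarrow>
    oderives T \<Gamma> (inst_N t A)"


section \<open>The translation\<close>

text \<open>
  \<open>interp \<Theta> A\<close> interprets \<open>Pred t\<close> by \<open>\<Theta> t\<close>.  It is only used for \<open>\<Theta>\<close> whose sole free numeric
  variables are those of \<open>t\<close>, so nothing needs to be lifted at the numeric quantifiers.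
\<close>

primrec interp :: "(trm \<Rightarrow> oform) \<Rightarrow> form \<Rightarrow> oform" where
  "interp \<Theta> (Eq s t) = OEq s t"
| "interp \<Theta> (Rel f ts) = ORel f ts"
| "interp \<Theta> (Pred t) = \<Theta> t"
| "interp \<Theta> (Neg A) = ONeg (interp \<Theta> A)"
| "interp \<Theta> (Con A B) = OCon (interp \<Theta> A) (interp \<Theta> B)"
| "interp \<Theta> (Dis A B) = ODis (interp \<Theta> A) (interp \<Theta> B)"
| "interp \<Theta> (Imp A B) = OImp (interp \<Theta> A) (interp \<Theta> B)"
| "interp \<Theta> (All A) = AllN (interp \<Theta> A)"
| "interp \<Theta> (Ex A) = ExN (interp \<Theta> A)"

definition hat :: "form \<Rightarrow> oform" where
  "hat = interp (\<lambda>t. ExO (In (OVar 0) t))"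

text \<open>\<open>In_below k t\<close> is \<open>t \<in> I\<^bsub>\<prec>\<alpha>\<^esub>\<close>, i.e. \<open>\<exists>i. t \<in> I\<^bsub>\<alpha>[i]\<^esub>\<close>, for \<open>\<alpha>\<close> the tree variable with index \<open>k\<close>.\<close>

definition In_below :: "nat \<Rightarrow> trm \<Rightarrow> oform" where
  "In_below k t = ExN (In (Sub (OVar k) (Var 0)) (lift_trm t))"


section \<open>The theory \<open>OID\<^sub>1\<close>\<close>

text \<open>
  For \<open>\<phi>(\<alpha>)\<close> with \<open>\<alpha>\<close> at tree index 0, \<open>at_child \<phi>\<close> is \<open>\<phi>(\<alpha>[i])\<close>, where \<open>i\<close> is a new numeric variable
  with index 0; the remaining numeric variables are shifted by one.
\<close>

definition at_child :: "oform \<Rightarrow> oform" where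
  "at_child = osubst shift (case_nat (Sub (OVar 0) (Var 0)) oshift)"

text \<open>
  The formulas in \<open>arith_axioms\<close> do not contain \<open>Pred\<close>, so \<open>hat\<close> merely embeds them.  They include
  the successor axioms, which count as defining axioms for the successor function.
\<close>

inductive_set oid1_axioms :: "form \<Rightarrow> oform set" for \<psi> :: form where
  arith: "A \<in> arith_axioms \<Longrightarrow> hat A \<in> oid1_axioms \<psi>"
| induction: "wf_oform A \<Longrightarrow>
    OImp (OCon (inst_N zero A)
               (AllN (OImp A (osubst (case_nat (suc (Var 0)) shift) OVar A))))
         (AllN A) \<in> oid1_axioms \<psi>"
| tree_induction: "wf_oform A \<Longrightarrow>
    OImp (OCon (AllO (OImp (IsE (OVar 0)) A))
               (AllO (OImp (OCon (ONeg (IsE (OVar 0))) (AllN (at_child A))) A)))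
         (AllO A) \<in> oid1_axioms \<psi>"
| child_e: "OImp (IsE (OVar 0)) (IsE (Sub (OVar 0) (Var 0))) \<in> oid1_axioms \<psi>"
| bounding: "wf_oform A \<Longrightarrow> no_tree_quant A \<Longrightarrow>
    OImp (AllN (ExO A)) (ExO (AllN (ExN (at_child A)))) \<in> oid1_axioms \<psi>"
| stage_e: "OImp (IsE (OVar 0)) (AllN (ONeg (In (OVar 0) (Var 0)))) \<in> oid1_axioms \<psi>"
| stage: "AllO (OImp (ONeg (IsE (OVar 0)))
    (AllN (OIff (In (OVar 0) (Var 0)) (interp (In_below 0) \<psi>)))) \<in> oid1_axioms \<psi>"

text \<open>
  The axioms in \<open>oid1_axioms\<close> do not imply that there is a tree different from \<open>e\<close>: the standard
  numbers with the single tree \<open>e\<close> and empty \<open>I\<close> form a model.  For \<open>\<psi>(x, P) \<equiv> (x = x)\<close> the formula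
  \<open>0 \<in> I\<close> is provable in \<open>ID\<^sub>1\<close>, but its translation fails in this model.  Hence \<open>OID\<^sub>1\<close> is taken
  to contain the additional axiom \<open>\<exists>\<alpha>. \<alpha> \<noteq> e\<close>.
\<close>

definition nontrivial_tree :: oform where
  "nontrivial_tree = ExO (ONeg (IsE (OVar 0)))"

definition oid1_proves :: "form \<Rightarrow> oform \<Rightarrow> bool" where
  "oid1_proves \<psi> A \<longleftrightarrow> oderives (insert nontrivial_tree (oid1_axioms \<psi>)) [] A"

end

theory Submission
  imports Defs
begin

text \<open>
  The translation commutes with the logical connectives, the number quantifiers and substitution, so
  it carries a derivation of \<open>ID\<^sub>1\<close> rule by rule to a derivation of \<open>OID\<^sub>1\<close>, provided the translated
  axioms are derivable (\<open>derives_hat\<close>).  Only the two axioms on \<open>I\<close> need an argument.  Write \<open>J\<close> for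
  \<open>\<exists>\<alpha>. x \<in> I\<^bsub>\<alpha>\<^esub>\<close>, the translation of \<open>x \<in> I\<close>.

  Leastness (\<open>least_provable\<close>).  If \<open>\<psi>(x, \<theta>)\<close> implies \<open>\<theta>(x)\<close>, then \<open>I\<^bsub>\<alpha>\<^esub> \<subseteq> \<theta>\<close> for all \<open>\<alpha>\<close> by induction on
  \<open>\<alpha>\<close>.  For \<open>\<alpha> = e\<close> the stage is empty.  Otherwise the induction hypothesis says \<open>I\<^bsub>\<prec>\<alpha>\<^esub> \<subseteq> \<theta>\<close>, and
  \<open>x \<in> I\<^bsub>\<alpha>\<^esub>\<close> gives \<open>\<psi>(x, I\<^bsub>\<prec>\<alpha>\<^esub>)\<close>, hence \<open>\<psi>(x, \<theta>)\<close> since \<open>\<psi>\<close> is monotone in its predicate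
  (\<open>positive_mono\<close>), hence \<open>\<theta>(x)\<close>.

  Closure (\<open>closure_provable\<close>).  The key is a reflection principle (\<open>positive_reflection\<close>): a
  positive formula true of \<open>J\<close> is already true of \<open>I\<^bsub>\<prec>\<beta>\<^esub>\<close> for some tree \<open>\<beta>\<close>.  It is proved by induction
  on the negation normal form.  At a universal quantifier each instance has its own tree; bounding
  supplies one tree \<open>\<gamma>\<close> whose children serve all instances.  A second use of bounding finds \<open>\<beta>\<close> with
  \<open>\<Union>\<^sub>i I\<^bsub>\<prec>\<gamma>[i]\<^esub> \<subseteq> I\<^bsub>\<prec>\<beta>\<^esub>\<close>, and monotonicity does the rest.  The second use rests on the fact that bounding
  turns every tree-quantifier-free set \<open>Q \<subseteq> J\<close> into a subset of a single \<open>I\<^bsub>\<prec>\<beta>\<^esub>\<close> (\<open>stage_bound\<close>): one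
  applies it to the formula \<open>x \<in> Q \<longrightarrow> x \<in> I\<^bsub>\<alpha>\<^esub>\<close>.  Conjunctions and atoms \<open>t \<in> J\<close> are settled by the same
  fact with other choices of \<open>Q\<close>.  Given \<open>\<psi>(x, J)\<close>, reflection yields \<open>\<psi>(x, I\<^bsub>\<prec>\<beta>\<^esub>)\<close>.  If \<open>\<beta> \<noteq> e\<close>, this is
  \<open>x \<in> I\<^bsub>\<beta>\<^esub>\<close>.  If \<open>\<beta> = e\<close>, then \<open>I\<^bsub>\<prec>\<beta>\<^esub>\<close> is empty, so \<open>\<psi>(x, I\<^bsub>\<prec>\<gamma>\<^esub>)\<close> holds by monotonicity for any tree
  \<open>\<gamma> \<noteq> e\<close>, of which there is one, and \<open>x \<in> I\<^bsub>\<gamma>\<^esub>\<close>.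
\<close>

section \<open>Substitution\<close>

lemma subst_trm_Var [simp]: "subst_trm Var t = t"
  by (induction t) (auto simp: map_idI)

lemma subst_trm_comp: "subst_trm \<sigma> (subst_trm \<rho> t) = subst_trm (\<lambda>n. subst_trm \<sigma> (\<rho> n)) t"
  by (induction t) auto

lemma up_Var [simp]: "up Var = Var"
  by (rule ext) (auto simp: up_def split: nat.splits)

lemma up_comp: "subst_trm (up \<sigma>) (up \<rho> n) = up (\<lambda>n. subst_trm \<sigma> (\<rho> n)) n"
  by (cases n) (auto simp: up_def subst_trm_comp)

lemma subst_otrm_OVar [simp]: "subst_otrm Var OVar a = a"
  by (induction a) auto

lemma subst_otrm_comp:
  "subst_otrm \<sigma> \<tau> (subst_otrm \<sigma>' \<tau>' a) =
   subst_otrm (\<lambda>n. subst_trm \<sigma> (\<sigma>' n)) (\<lambda>n. subst_otrm \<sigma> \<tau> (\<tau>' n)) a"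
  by (induction a) (auto simp: subst_trm_comp)

lemma nup_OVar [simp]: "nup OVar = OVar"
  by (rule ext) (auto simp: nup_def)

lemma oup_OVar [simp]: "oup OVar = OVar"
  by (rule ext) (auto simp: oup_def split: nat.splits)

lemma nup_oshift [simp]: "nup oshift = oshift"
  by (rule ext) (simp add: nup_def)

lemma nup_comp: "subst_otrm (up \<sigma>) (nup \<tau>) (nup \<tau>' n) = nup (\<lambda>n. subst_otrm \<sigma> \<tau> (\<tau>' n)) n"
  by (auto simp: nup_def subst_otrm_comp up_def)

lemma oup_comp: "subst_otrm \<sigma> (oup \<tau>) (oup \<tau>' n) = oup (\<lambda>n. subst_otrm \<sigma> \<tau> (\<tau>' n)) n"
  by (cases n) (auto simp: oup_def subst_otrm_comp)

lemma osubst_id [simp]: "osubst Var OVar A = A"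
  by (induction A) (auto simp: map_idI)

lemma osubst_comp:
  "osubst \<sigma> \<tau> (osubst \<sigma>' \<tau>' A) =
   osubst (\<lambda>n. subst_trm \<sigma> (\<sigma>' n)) (\<lambda>n. subst_otrm \<sigma> \<tau> (\<tau>' n)) A"
  by (induction A arbitrary: \<sigma> \<tau> \<sigma>' \<tau>')
    (auto simp: subst_trm_comp subst_otrm_comp up_comp nup_comp oup_comp)

lemma osubst_cong:
  "(\<And>n. \<sigma> n = \<sigma>' n) \<Longrightarrow> (\<And>n. \<tau> n = \<tau>' n) \<Longrightarrow> osubst \<sigma> \<tau> A = osubst \<sigma>' \<tau>' A"
  by (metis ext)

text \<open>
  Below a quantifier, a lifted body is \<open>osubst (up shift) OVar A\<close>; instantiating it with the newest
  variable recovers \<open>A\<close>.  So \<open>A\<close> follows from \<open>lift_N (AllN A)\<close> and, likewise, implies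
  \<open>lift_N (ExN A)\<close>.
\<close>

lemma inst_N_lift_N_bound [simp]: "inst_N (Var 0) (osubst (up shift) OVar A) = A"
proof -
  have "inst_N (Var 0) (osubst (up shift) OVar A) = osubst Var OVar A"
    unfolding osubst_comp by (rule osubst_cong) (auto simp: up_def split: nat.splits)
  then show ?thesis by simp
qed

lemma inst_O_lift_O_bound [simp]: "inst_O (OVar 0) (osubst Var (oup oshift) A) = A"
proof -
  have "inst_O (OVar 0) (osubst Var (oup oshift) A) = osubst Var OVar A"
    unfolding osubst_comp by (rule osubst_cong) (auto simp: oup_def split: nat.splits)
  then show ?thesis by simp
qed

lemma wf_subst_trm: "wf_trm t \<Longrightarrow> \<forall>n. wf_trm (\<sigma> n) \<Longrightarrow> wf_trm (subst_trm \<sigma> t)"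
  by (induction t) auto

lemma wf_subst_trmD: "wf_trm (subst_trm \<sigma> t) \<Longrightarrow> wf_trm t"
  by (induction t) auto

lemma wf_subst_trm_iff [simp]: "\<forall>n. wf_trm (\<sigma> n) \<Longrightarrow> wf_trm (subst_trm \<sigma> t) \<longleftrightarrow> wf_trm t"
  using wf_subst_trm wf_subst_trmD by blast

lemma wf_up [simp]: "\<forall>n. wf_trm (\<sigma> n) \<Longrightarrow> \<forall>n. wf_trm (up \<sigma> n)"
  by (auto simp: up_def wf_subst_trm split: nat.splits)

lemma wf_subst_otrm:
  "wf_otrm a \<Longrightarrow> \<forall>n. wf_trm (\<sigma> n) \<Longrightarrow> \<forall>n. wf_otrm (\<tau> n) \<Longrightarrow> wf_otrm (subst_otrm \<sigma> \<tau> a)"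
  by (induction a) (auto simp: wf_subst_trm)

lemma wf_subst_otrmD: "wf_otrm (subst_otrm \<sigma> \<tau> a) \<Longrightarrow> wf_otrm a"
  by (induction a) (auto dest: wf_subst_trmD)

lemma wf_subst_otrm_iff [simp]:
  "\<forall>n. wf_trm (\<sigma> n) \<Longrightarrow> \<forall>n. wf_otrm (\<tau> n) \<Longrightarrow> wf_otrm (subst_otrm \<sigma> \<tau> a) \<longleftrightarrow> wf_otrm a"
  using wf_subst_otrm wf_subst_otrmD by blast

lemma wf_nup [simp]: "\<forall>n. wf_otrm (\<tau> n) \<Longrightarrow> \<forall>n. wf_otrm (nup \<tau> n)"
  by (auto simp: nup_def wf_subst_otrm)

lemma wf_oup [simp]: "\<forall>n. wf_otrm (\<tau> n) \<Longrightarrow> \<forall>n. wf_otrm (oup \<tau> n)"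
  by (auto simp: oup_def wf_subst_otrm split: nat.splits)

lemma wf_osubst:
  "wf_oform A \<Longrightarrow> \<forall>n. wf_trm (\<sigma> n) \<Longrightarrow> \<forall>n. wf_otrm (\<tau> n) \<Longrightarrow> wf_oform (osubst \<sigma> \<tau> A)"
  by (induction A arbitrary: \<sigma> \<tau>) (auto simp: wf_subst_trm wf_subst_otrm wf_up wf_nup wf_oup)

lemma wf_osubstD: "wf_oform (osubst \<sigma> \<tau> A) \<Longrightarrow> wf_oform A"
  by (induction A arbitrary: \<sigma> \<tau>) (auto dest: wf_subst_trmD wf_subst_otrmD)

lemma wf_osubst_iff [simp]:
  "\<forall>n. wf_trm (\<sigma> n) \<Longrightarrow> \<forall>n. wf_otrm (\<tau> n) \<Longrightarrow> wf_oform (osubst \<sigma> \<tau> A) \<longleftrightarrow> wf_oform A"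
  using wf_osubst wf_osubstD by blast

lemma wf_inst: "wf_oform A \<Longrightarrow> wf_trm t \<Longrightarrow> wf_oform (inst_N t A)"
  "wf_oform A \<Longrightarrow> wf_otrm a \<Longrightarrow> wf_oform (inst_O a A)"
  by (auto intro!: wf_osubst split: nat.splits)

lemma no_tree_quant_osubst [simp]: "no_tree_quant (osubst \<sigma> \<tau> A) = no_tree_quant A"
  by (induction A arbitrary: \<sigma> \<tau>) auto

section \<open>Structural rules of the two-sorted calculus\<close>

declare oderives.Hyp [simp]

abbreviation wf_context :: "oform list \<Rightarrow> bool" where
  "wf_context \<Gamma> \<equiv> \<forall>B \<in> set \<Gamma>. wf_oform B"

lemma oderives_wf: "oderives T \<Gamma> A \<Longrightarrow> wf_oform A \<and> wf_context \<Gamma>"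
proof (induction rule: oderives.induct)
  case (EqSubst \<Gamma> s t A)
  then show ?case by (simp add: wf_inst)
qed (auto simp: wf_inst)

lemmas wf_conclusion = conjunct1[OF oderives_wf]
lemmas wf_premises = conjunct2[OF oderives_wf]

lemma weakening: "oderives T \<Gamma> A \<Longrightarrow> set \<Gamma> \<subseteq> set \<Delta> \<Longrightarrow> wf_context \<Delta> \<Longrightarrow> oderives T \<Delta> A"
proof (induction arbitrary: \<Delta> rule: oderives.induct)
  case (NegI A \<Gamma> B)
  have "wf_oform A" using wf_premises[OF NegI.hyps(1)] by simp
  then show ?case using NegI.prems by (intro oderives.NegI[of T A \<Delta> B] NegI.IH) auto
next
  case (Classical A \<Gamma> B)
  have "wf_oform A" using wf_premises[OF Classical.hyps(1)] by simp
  then show ?case using Classical.prems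
    by (intro oderives.Classical[of T A \<Delta> B] Classical.IH) auto
next
  case (DisE \<Gamma> A B C)
  have "wf_oform A" "wf_oform B" using wf_conclusion[OF DisE.hyps(1)] by auto
  then show ?case using DisE.prems by (intro oderives.DisE[of T \<Delta> A B C] DisE.IH) auto
next
  case (ImpI A \<Gamma> B)
  have "wf_oform A" using wf_premises[OF ImpI.hyps(1)] by simp
  then show ?case using ImpI.prems by (intro oderives.ImpI ImpI.IH) auto
next
  case (AllNI \<Gamma> A)
  then show ?case by (intro oderives.AllNI AllNI.IH) auto
next
  case (AllOI \<Gamma> A)
  then show ?case by (intro oderives.AllOI AllOI.IH) auto
next
  case (ExNE \<Gamma> A C)
  have "wf_oform A" using wf_conclusion[OF ExNE.hyps(1)] by simp
  then show ?case using ExNE.prems ExNE.hyps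
    by (intro oderives.ExNE[of T \<Delta> A C] ExNE.IH) auto
next
  case (ExOE \<Gamma> A C)
  have "wf_oform A" using wf_conclusion[OF ExOE.hyps(1)] by simp
  then show ?case using ExOE.prems ExOE.hyps
    by (intro oderives.ExOE[of T \<Delta> A C] ExOE.IH) auto
qed (auto intro: oderives.intros)

lemma cut: "oderives T \<Gamma> A \<Longrightarrow> oderives T (A # \<Gamma>) B \<Longrightarrow> oderives T \<Gamma> B"
  by (blast intro: oderives.intros)

lemma from_theorem: "oderives T [] A \<Longrightarrow> wf_context \<Gamma> \<Longrightarrow> oderives T \<Gamma> A"
  by (rule weakening) auto

lemma apply_theorem:
  "oderives T \<Gamma> A \<Longrightarrow> oderives T [] (OImp A B) \<Longrightarrow> oderives T \<Gamma> B"
  using oderives.ImpE[OF from_theorem] wf_premises by blast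

section \<open>Propositional consequence\<close>

primrec truth_value :: "(oform \<Rightarrow> bool) \<Rightarrow> oform \<Rightarrow> bool" where
  "truth_value p (OEq s t) = p (OEq s t)"
| "truth_value p (ORel f ts) = p (ORel f ts)"
| "truth_value p (IsE a) = p (IsE a)"
| "truth_value p (In a t) = p (In a t)"
| "truth_value p (ONeg A) = (\<not> truth_value p A)"
| "truth_value p (OCon A B) = (truth_value p A \<and> truth_value p B)"
| "truth_value p (ODis A B) = (truth_value p A \<or> truth_value p B)"
| "truth_value p (OImp A B) = (truth_value p A \<longrightarrow> truth_value p B)"
| "truth_value p (AllN A) = p (AllN A)"
| "truth_value p (ExN A) = p (ExN A)"
| "truth_value p (AllO A) = p (AllO A)"
| "truth_value p (ExO A) = p (ExO A)"

text \<open>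
  Quantified formulas count as atoms for \<open>truth_value\<close>.  The lemma turns all propositional reasoning
  inside the calculus into reasoning about truth values.  If \<open>A\<close> were not derivable from \<open>\<Gamma>\<close>, Zorn's
  lemma would give a maximal set \<open>M \<supseteq> \<Gamma>\<close> from which \<open>A\<close> is not derivable; membership in \<open>M\<close> then
  commutes with the connectives, so it is a valuation that makes \<open>\<Gamma>\<close> true and \<open>A\<close> false.
\<close>

lemma propositional_completeness:
  assumes wf: "wf_context \<Gamma>" "wf_oform A"
    and sem: "\<And>p. \<forall>B \<in> set \<Gamma>. truth_value p B \<Longrightarrow> truth_value p A"
  shows "oderives T \<Gamma> A"
proof (rule ccontr)
  assume not: "\<not> oderives T \<Gamma> A"
  define \<S> where "\<S> = {S. set \<Gamma> \<subseteq> S \<and> (\<forall>\<Delta>. set \<Delta> \<subseteq> S \<longrightarrow> \<not> oderives T \<Delta> A)}"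
  have "\<exists>M\<in>\<S>. \<forall>X\<in>\<S>. M \<subseteq> X \<longrightarrow> X = M"
  proof (rule subset_Zorn_nonempty)
    show "\<S> \<noteq> {}" using not weakening[OF _ _ wf(1)] unfolding \<S>_def by blast
  next
    fix C assume C: "C \<noteq> {}" "subset.chain \<S> C"
    have "\<not> oderives T \<Delta> A" if sub: "set \<Delta> \<subseteq> \<Union> C" for \<Delta>
    proof -
      obtain S where "S \<in> C" "set \<Delta> \<subseteq> S"
        using finite_subset_Union_chain[OF _ sub C] by auto
      moreover have "S \<in> \<S>" using C(2) \<open>S \<in> C\<close> by (auto simp: subset.chain_def)
      ultimately show ?thesis unfolding \<S>_def by blast
    qed
    moreover have "set \<Gamma> \<subseteq> \<Union> C" using C unfolding subset.chain_def \<S>_def by blast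
    ultimately show "\<Union> C \<in> \<S>" unfolding \<S>_def by blast
  qed
  then obtain M where "M \<in> \<S>" and max: "\<And>X. X \<in> \<S> \<Longrightarrow> M \<subseteq> X \<Longrightarrow> X = M" by blast
  then have \<Gamma>M: "set \<Gamma> \<subseteq> M" and avoid: "\<And>\<Delta>. set \<Delta> \<subseteq> M \<Longrightarrow> \<not> oderives T \<Delta> A"
    unfolding \<S>_def by auto
  have proves: "\<exists>\<Delta>. set \<Delta> \<subseteq> M \<and> oderives T (B # \<Delta>) A" if "B \<notin> M" for B
  proof -
    have "insert B M \<notin> \<S>" using max[of "insert B M"] that by blast
    then obtain \<Delta> where \<Delta>: "set \<Delta> \<subseteq> insert B M" "oderives T \<Delta> A"
      using \<Gamma>M unfolding \<S>_def by blast
    have "B \<in> set \<Delta>" using \<Delta> avoid[of \<Delta>] by blast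
    then have "oderives T (B # filter (\<lambda>C. C \<noteq> B) \<Delta>) A"
      using \<Delta> wf_premises[OF \<Delta>(2)] by (intro weakening[OF \<Delta>(2)]) auto
    then show ?thesis using \<Delta>(1) by (intro exI[of _ "filter (\<lambda>C. C \<noteq> B) \<Delta>"]) auto
  qed
  have closed: "B \<in> M" if \<Delta>: "set \<Delta> \<subseteq> M" "oderives T \<Delta> B" for \<Delta> B
  proof (rule ccontr)
    assume "B \<notin> M"
    then obtain \<Delta>' where \<Delta>': "set \<Delta>' \<subseteq> M" "oderives T (B # \<Delta>') A" using proves by blast
    have wf': "wf_context (\<Delta> @ \<Delta>')" "wf_oform B"
      using wf_premises[OF \<Delta>(2)] wf_premises[OF \<Delta>'(2)] by auto
    have "oderives T (\<Delta> @ \<Delta>') A"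
      by (rule cut[OF weakening[OF \<Delta>(2)] weakening[OF \<Delta>'(2)]]) (use wf' in auto)
    then show False using avoid[of "\<Delta> @ \<Delta>'"] \<Delta> \<Delta>' by auto
  qed
  have neg: "ONeg B \<in> M \<longleftrightarrow> B \<notin> M" if "wf_oform B" for B
  proof
    assume "ONeg B \<in> M"
    show "B \<notin> M"
    proof
      assume "B \<in> M"
      have "oderives T [B, ONeg B] A"
        by (rule oderives.Classical[of _ _ _ B]) (use that wf in auto)
      then show False using avoid[of "[B, ONeg B]"] \<open>B \<in> M\<close> \<open>ONeg B \<in> M\<close> by auto
    qed
  next
    assume "B \<notin> M"
    then obtain \<Delta> where \<Delta>: "set \<Delta> \<subseteq> M" "oderives T (B # \<Delta>) A" using proves by blast
    show "ONeg B \<in> M"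
    proof (rule ccontr)
      assume "ONeg B \<notin> M"
      then obtain \<Delta>' where \<Delta>': "set \<Delta>' \<subseteq> M" "oderives T (ONeg B # \<Delta>') A" using proves by blast
      have wf': "wf_context (ONeg A # \<Delta> @ \<Delta>')"
        using wf_premises[OF \<Delta>(2)] wf_premises[OF \<Delta>'(2)] wf by auto
      have "oderives T (B # ONeg A # \<Delta> @ \<Delta>') A"
        by (rule weakening[OF \<Delta>(2)]) (use wf' that in auto)
      then have "oderives T (ONeg A # \<Delta> @ \<Delta>') (ONeg B)"
        by (rule oderives.NegI) (use wf' that in auto)
      moreover have "oderives T (ONeg B # ONeg A # \<Delta> @ \<Delta>') A"
        by (rule weakening[OF \<Delta>'(2)]) (use wf' that in auto)
      ultimately have "oderives T (ONeg A # \<Delta> @ \<Delta>') A" by (rule cut)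
      then have "oderives T (\<Delta> @ \<Delta>') A"
        by (rule oderives.Classical) (use wf' in auto)
      then show False using avoid[of "\<Delta> @ \<Delta>'"] \<Delta> \<Delta>' by auto
    qed
  qed
  have hyp: "oderives T [B] B" if "wf_oform B" for B using that by auto
  have con: "OCon B C \<in> M \<longleftrightarrow> B \<in> M \<and> C \<in> M" if w: "wf_oform B" "wf_oform C" for B C
  proof
    have "oderives T [OCon B C] (OCon B C)" using hyp w by simp
    then show "B \<in> M \<and> C \<in> M" if "OCon B C \<in> M"
      
      using closed[of "[OCon B C]" B, OF _ oderives.ConE1] closed[of "[OCon B C]" C, OF _ oderives.ConE2]
        that by simp
    have "oderives T [B, C] (OCon B C)" using w by (auto intro!: oderives.ConI)
    then show "OCon B C \<in> M" if "B \<in> M \<and> C \<in> M" using closed[of "[B, C]"] that by simp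
  qed
  have dis: "ODis B C \<in> M \<longleftrightarrow> B \<in> M \<or> C \<in> M" if w: "wf_oform B" "wf_oform C" for B C
  proof
    assume *: "ODis B C \<in> M"
    show "B \<in> M \<or> C \<in> M"
    proof (rule ccontr)
      assume "\<not> (B \<in> M \<or> C \<in> M)"
      then have "ONeg B \<in> M" using neg w by blast
      have "oderives T [ODis B C, ONeg B] C"
      proof (rule oderives.DisE[of _ _ B C])
        show "oderives T [B, ODis B C, ONeg B] C"
          by (rule oderives.Classical[of _ _ _ B]) (use w in auto)
      qed (use w in auto)
      then show False
        using closed[of "[ODis B C, ONeg B]" C] * \<open>ONeg B \<in> M\<close> \<open>\<not> (B \<in> M \<or> C \<in> M)\<close> by auto
    qed
  next
    assume "B \<in> M \<or> C \<in> M"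
    then show "ODis B C \<in> M"
      using closed[of "[B]", OF _ oderives.DisI1] closed[of "[C]", OF _ oderives.DisI2] w by auto
  qed
  have imp: "OImp B C \<in> M \<longleftrightarrow> (B \<in> M \<longrightarrow> C \<in> M)" if w: "wf_oform B" "wf_oform C" for B C
  proof
    have "oderives T [OImp B C, B] C"
      by (rule oderives.ImpE[of _ _ B]) (use w in auto)
    then show "B \<in> M \<longrightarrow> C \<in> M" if "OImp B C \<in> M" using closed[of "[OImp B C, B]"] that by auto
  next
    assume *: "B \<in> M \<longrightarrow> C \<in> M"
    have "oderives T [B, ONeg B] C"
      by (rule oderives.Classical[of _ _ _ B]) (use w in auto)
    then have "oderives T [ONeg B] (OImp B C)" by (rule oderives.ImpI)
    then have 1: "OImp B C \<in> M" if "ONeg B \<in> M" using closed[of "[ONeg B]"] that by simp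
    have "oderives T [C] (OImp B C)" by (rule oderives.ImpI) (use w in auto)
    then have 2: "OImp B C \<in> M" if "C \<in> M" using closed[of "[C]"] that by simp
    show "OImp B C \<in> M" using 1 2 * neg[OF w(1)] by blast
  qed
  have truth: "wf_oform B \<Longrightarrow> truth_value (\<lambda>C. C \<in> M) B \<longleftrightarrow> B \<in> M" for B
    by (induction B) (auto simp: neg con dis imp)
  have "A \<notin> M" using avoid[of "[A]"] hyp wf by auto
  then show False using sem[of "\<lambda>C. C \<in> M"] truth wf \<Gamma>M by blast
qed

lemma consequence:
  assumes "oderives T \<Gamma> A" "oderives T \<Gamma> B" "wf_oform C"
    and "\<And>p. truth_value p A \<Longrightarrow> truth_value p B \<Longrightarrow> truth_value p C"
  shows "oderives T \<Gamma> C"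
proof -
  have "oderives T \<Gamma> (OImp A (OImp B C))"
    using assms wf_conclusion[OF assms(1)] wf_conclusion[OF assms(2)] wf_premises[OF assms(1)]
    by (intro propositional_completeness) auto
  then show ?thesis using assms(1,2) by (blast intro: oderives.ImpE)
qed

lemma imp_refl: "wf_oform A \<Longrightarrow> wf_context \<Gamma> \<Longrightarrow> oderives T \<Gamma> (OImp A A)"
  by (intro oderives.ImpI) auto

lemma iff_refl: "wf_oform A \<Longrightarrow> wf_context \<Gamma> \<Longrightarrow> oderives T \<Gamma> (OIff A A)"
  by (intro oderives.ConI imp_refl)

lemma case_distinction:
  assumes "oderives T (A # \<Gamma>) B" "oderives T (ONeg A # \<Gamma>) B"
  shows "oderives T \<Gamma> B"
  by (rule consequence[OF oderives.ImpI[OF assms(1)] oderives.ImpI[OF assms(2)]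
        wf_conclusion[OF assms(1)]]) (unfold truth_value.simps, blast)

lemma imp_trans:
  assumes "oderives T \<Gamma> (OImp A B)" "oderives T \<Gamma> (OImp B C)"
  shows "oderives T \<Gamma> (OImp A C)"
proof -
  have "wf_oform (OImp A C)"
    using wf_conclusion[OF assms(1)] wf_conclusion[OF assms(2)] by simp
  then show ?thesis by (rule consequence[OF assms]) (unfold truth_value.simps, blast)
qed

lemma imp_Con:
  assumes "oderives T \<Gamma> (OImp A A')" "oderives T \<Gamma> (OImp B B')"
  shows "oderives T \<Gamma> (OImp (OCon A B) (OCon A' B'))"
proof -
  have "wf_oform (OImp (OCon A B) (OCon A' B'))"
    using wf_conclusion[OF assms(1)] wf_conclusion[OF assms(2)] by simp
  then show ?thesis by (rule consequence[OF assms]) (unfold truth_value.simps, blast)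
qed

lemma imp_Dis:
  assumes "oderives T \<Gamma> (OImp A A')" "oderives T \<Gamma> (OImp B B')"
  shows "oderives T \<Gamma> (OImp (ODis A B) (ODis A' B'))"
proof -
  have "wf_oform (OImp (ODis A B) (ODis A' B'))"
    using wf_conclusion[OF assms(1)] wf_conclusion[OF assms(2)] by simp
  then show ?thesis by (rule consequence[OF assms]) (unfold truth_value.simps, blast)
qed

lemma iff_trans:
  assumes "oderives T \<Gamma> (OIff A B)" "oderives T \<Gamma> (OIff B C)"
  shows "oderives T \<Gamma> (OIff A C)"
proof -
  have "wf_oform (OIff A C)"
    using wf_conclusion[OF assms(1)] wf_conclusion[OF assms(2)] by simp
  then show ?thesis by (rule consequence[OF assms]) (unfold truth_value.simps, blast)
qed

lemma iff_Con:
  assumes "oderives T \<Gamma> (OIff A A')" "oderives T \<Gamma> (OIff B B')"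
  shows "oderives T \<Gamma> (OIff (OCon A B) (OCon A' B'))"
proof -
  have "wf_oform (OIff (OCon A B) (OCon A' B'))"
    using wf_conclusion[OF assms(1)] wf_conclusion[OF assms(2)] by simp
  then show ?thesis by (rule consequence[OF assms]) (unfold truth_value.simps, blast)
qed

lemma iff_Dis:
  assumes "oderives T \<Gamma> (OIff A A')" "oderives T \<Gamma> (OIff B B')"
  shows "oderives T \<Gamma> (OIff (ODis A B) (ODis A' B'))"
proof -
  have "wf_oform (OIff (ODis A B) (ODis A' B'))"
    using wf_conclusion[OF assms(1)] wf_conclusion[OF assms(2)] by simp
  then show ?thesis by (rule consequence[OF assms]) (unfold truth_value.simps, blast)
qed

lemma iff_Imp:
  assumes "oderives T \<Gamma> (OIff (ONeg A) A')" "oderives T \<Gamma> (OIff B B')"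
  shows "oderives T \<Gamma> (OIff (OImp A B) (ODis A' B'))"
proof -
  have "wf_oform (OIff (OImp A B) (ODis A' B'))"
    using wf_conclusion[OF assms(1)] wf_conclusion[OF assms(2)] by simp
  then show ?thesis by (rule consequence[OF assms]) (unfold truth_value.simps, blast)
qed

lemma iff_not_Con:
  assumes "oderives T \<Gamma> (OIff (ONeg A) A')" "oderives T \<Gamma> (OIff (ONeg B) B')"
  shows "oderives T \<Gamma> (OIff (ONeg (OCon A B)) (ODis A' B'))"
proof -
  have "wf_oform (OIff (ONeg (OCon A B)) (ODis A' B'))"
    using wf_conclusion[OF assms(1)] wf_conclusion[OF assms(2)] by simp
  then show ?thesis by (rule consequence[OF assms]) (unfold truth_value.simps, blast)
qed

lemma iff_not_Dis:
  assumes "oderives T \<Gamma> (OIff (ONeg A) A')" "oderives T \<Gamma> (OIff (ONeg B) B')"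
  shows "oderives T \<Gamma> (OIff (ONeg (ODis A B)) (OCon A' B'))"
proof -
  have "wf_oform (OIff (ONeg (ODis A B)) (OCon A' B'))"
    using wf_conclusion[OF assms(1)] wf_conclusion[OF assms(2)] by simp
  then show ?thesis by (rule consequence[OF assms]) (unfold truth_value.simps, blast)
qed

lemma iff_not_Imp:
  assumes "oderives T \<Gamma> (OIff A A')" "oderives T \<Gamma> (OIff (ONeg B) B')"
  shows "oderives T \<Gamma> (OIff (ONeg (OImp A B)) (OCon A' B'))"
proof -
  have "wf_oform (OIff (ONeg (OImp A B)) (OCon A' B'))"
    using wf_conclusion[OF assms(1)] wf_conclusion[OF assms(2)] by simp
  then show ?thesis by (rule consequence[OF assms]) (unfold truth_value.simps, blast)
qed

lemma iff_not_not:
  assumes "oderives T \<Gamma> (OIff A A')"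
  shows "oderives T \<Gamma> (OIff (ONeg (ONeg A)) A')"
proof -
  have "wf_oform (OIff (ONeg (ONeg A)) A')" using wf_conclusion[OF assms] by simp
  then show ?thesis by (rule consequence[OF assms assms]) (unfold truth_value.simps, blast)
qed

section \<open>Quantifier rules\<close>

lemma AllN_elim_Var: "oderives T \<Gamma> (lift_N (AllN A)) \<Longrightarrow> oderives T \<Gamma> A"
  using oderives.AllNE[of T \<Gamma> "osubst (up shift) OVar A" "Var 0"] by simp

lemma AllN_hyp_Var: "lift_N (AllN A) \<in> set \<Gamma> \<Longrightarrow> wf_context \<Gamma> \<Longrightarrow> oderives T \<Gamma> A"
  by (rule AllN_elim_Var) (rule oderives.Hyp)

lemma AllO_hyp_Var:
  assumes "lift_O (AllO A) \<in> set \<Gamma>" "wf_context \<Gamma>"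
  shows "oderives T \<Gamma> A"
proof -
  have "oderives T \<Gamma> (AllO (osubst Var (oup oshift) A))"
    using assms by auto
  from oderives.AllOE[OF this, of "OVar 0"] show ?thesis by simp
qed

lemma ExN_Var:
  assumes "oderives T \<Gamma> A"
  shows "oderives T \<Gamma> (ExN (osubst (up shift) OVar A))"
  by (rule oderives.ExNI[of _ _ "Var 0"]) (use assms wf_conclusion[OF assms] in auto)

lemma ExO_Var:
  assumes "oderives T \<Gamma> A"
  shows "oderives T \<Gamma> (ExO (osubst Var (oup oshift) A))"
  by (rule oderives.ExOI[of _ _ "OVar 0"]) (use assms wf_conclusion[OF assms] in auto)

lemma AllN_imp:
  assumes "oderives T (map lift_N \<Gamma>) (OImp A B)"
  shows "oderives T \<Gamma> (OImp (AllN A) (AllN B))"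
proof -
  have wf: "wf_context (map lift_N (AllN A # \<Gamma>))"
    using wf_conclusion[OF assms] wf_premises[OF assms] by simp
  have "oderives T (map lift_N (AllN A # \<Gamma>)) B"
    by (rule oderives.ImpE[OF weakening[OF assms _ wf] AllN_hyp_Var]) (use wf in auto)
  then show ?thesis by (intro oderives.ImpI oderives.AllNI)
qed

text \<open>
  Elimination of existential quantifiers with the side formulas on the right of an implication.  With
  \<open>\<Gamma>\<close> and \<open>B\<close> lifted, the bound variable of the quantifier serves as the eigenvariable.
\<close>

lemma ExN_elim_imp:
  assumes "oderives T (map lift_N \<Gamma>) (OImp A (lift_N B))" "wf_oform B"
  shows "oderives T \<Gamma> (OImp (ExN A) B)"
proof -
  have wf: "wf_context (A # map lift_N (ExN A # \<Gamma>))"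
    using wf_conclusion[OF assms(1)] wf_premises[OF assms(1)] by auto
  have "oderives T (A # map lift_N (ExN A # \<Gamma>)) (lift_N B)"
    by (rule oderives.ImpE[OF weakening[OF assms(1) _ wf]]) (use wf in auto)
  then have "oderives T (ExN A # \<Gamma>) B"
    by (rule oderives.ExNE[rotated]) (use wf assms(2) in auto)
  then show ?thesis by (rule oderives.ImpI)
qed

lemma ExO_elim_imp:
  assumes "oderives T (map lift_O \<Gamma>) (OImp A (lift_O B))" "wf_oform B"
  shows "oderives T \<Gamma> (OImp (ExO A) B)"
proof -
  have wf: "wf_context (A # map lift_O (ExO A # \<Gamma>))"
    using wf_conclusion[OF assms(1)] wf_premises[OF assms(1)] by auto
  have "oderives T (A # map lift_O (ExO A # \<Gamma>)) (lift_O B)"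
    by (rule oderives.ImpE[OF weakening[OF assms(1) _ wf]]) (use wf in auto)
  then have "oderives T (ExO A # \<Gamma>) B"
    by (rule oderives.ExOE[rotated]) (use wf assms(2) in auto)
  then show ?thesis by (rule oderives.ImpI)
qed

lemma ExN_imp:
  assumes "oderives T (map lift_N \<Gamma>) (OImp A B)"
  shows "oderives T \<Gamma> (OImp (ExN A) (ExN B))"
proof (rule ExN_elim_imp)
  have wf: "wf_oform A" "wf_oform B" "wf_context (map lift_N \<Gamma>)"
    using wf_conclusion[OF assms] wf_premises[OF assms] by auto
  then have "oderives T (A # map lift_N \<Gamma>) B"
    by (intro oderives.ImpE[OF weakening[OF assms]]) auto
  from ExN_Var[OF this] show "oderives T (map lift_N \<Gamma>) (OImp A (lift_N (ExN B)))"
    by (simp add: oderives.ImpI)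
  show "wf_oform (ExN B)" using wf by simp
qed

lemma ExO_imp:
  assumes "oderives T (map lift_O \<Gamma>) (OImp A B)"
  shows "oderives T \<Gamma> (OImp (ExO A) (ExO B))"
proof (rule ExO_elim_imp)
  have wf: "wf_oform A" "wf_oform B" "wf_context (map lift_O \<Gamma>)"
    using wf_conclusion[OF assms] wf_premises[OF assms] by auto
  then have "oderives T (A # map lift_O \<Gamma>) B"
    by (intro oderives.ImpE[OF weakening[OF assms]]) auto
  from ExO_Var[OF this] show "oderives T (map lift_O \<Gamma>) (OImp A (lift_O (ExO B)))"
    by (simp add: oderives.ImpI)
  show "wf_oform (ExO B)" using wf by simp
qed

lemma AllN_iff:
  assumes "oderives T [] (OIff A B)"
  shows "oderives T [] (OIff (AllN A) (AllN B))"
proof -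
  have "oderives T [] (OImp A B)" "oderives T [] (OImp B A)"
    using assms by (auto intro: oderives.ConE1 oderives.ConE2)
  then show ?thesis by (intro oderives.ConI AllN_imp) simp_all
qed

lemma ExN_iff:
  assumes "oderives T [] (OIff A B)"
  shows "oderives T [] (OIff (ExN A) (ExN B))"
proof -
  have "oderives T [] (OImp A B)" "oderives T [] (OImp B A)"
    using assms by (auto intro: oderives.ConE1 oderives.ConE2)
  then show ?thesis by (intro oderives.ConI ExN_imp) simp_all
qed

lemma not_AllN:
  assumes wf: "wf_oform A"
  shows "oderives T [] (OIff (ONeg (AllN A)) (ExN (ONeg A)))"
proof (intro oderives.ConI oderives.ImpI)
  let ?\<Gamma> = "[ONeg (ExN (ONeg A)), ONeg (AllN A)]"
  have "oderives T (ONeg A # map lift_N ?\<Gamma>) (ExN (osubst (up shift) OVar (ONeg A)))"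
    by (intro ExN_Var) (use wf in auto)
  then have "oderives T (map lift_N ?\<Gamma>) A"
    by (rule oderives.Classical) (use wf in auto)
  then have "oderives T ?\<Gamma> (AllN A)" by (rule oderives.AllNI)
  then show "oderives T [ONeg (AllN A)] (ExN (ONeg A))"
    by (rule oderives.Classical) (use wf in auto)
next
  let ?\<Gamma> = "[ONeg A, lift_N (ExN (ONeg A))]"
  have "oderives T (lift_N (AllN A) # ?\<Gamma>) A" using wf by (intro AllN_hyp_Var) auto
  then have "oderives T ?\<Gamma> (ONeg (lift_N (AllN A)))"
    by (rule oderives.NegI) (use wf in auto)
  then show "oderives T [ExN (ONeg A)] (ONeg (AllN A))"
    by (intro oderives.ExNE[of _ _ "ONeg A" "ONeg (AllN A)"]) (use wf in auto)
qed

lemma not_ExN: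
  assumes wf: "wf_oform A"
  shows "oderives T [] (OIff (ONeg (ExN A)) (AllN (ONeg A)))"
proof (intro oderives.ConI oderives.ImpI)
  let ?\<Gamma> = "[A, lift_N (ONeg (ExN A))]"
  have "oderives T ?\<Gamma> (lift_N (ExN A))" using wf ExN_Var[of T ?\<Gamma> A] by auto
  then have "oderives T [lift_N (ONeg (ExN A))] (ONeg A)"
    by (rule oderives.NegI) (use wf in auto)
  then show "oderives T [ONeg (ExN A)] (AllN (ONeg A))" by (auto intro: oderives.AllNI)
next
  let ?\<Gamma> = "[ExN A, AllN (ONeg A)]"
  let ?\<Delta> = "A # map lift_N ?\<Gamma>"
  have "oderives T ?\<Delta> (ONeg A)" using wf by (intro AllN_hyp_Var) auto
  then have "oderives T ?\<Delta> (lift_N (ONeg (ExN A)))"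
    by (rule consequence[of T ?\<Delta> A "ONeg A", rotated]) (use wf in simp_all)
  then have "oderives T ?\<Gamma> (ONeg (ExN A))"
    by (intro oderives.ExNE[of _ _ "A" "ONeg (ExN A)"]) (use wf in auto)
  then show "oderives T [AllN (ONeg A)] (ONeg (ExN A))"
    by (rule oderives.NegI[rotated]) (use wf in auto)
qed

lemma ExN_ExO_swap:
  assumes wf: "wf_oform A"
  shows "oderives T [] (OImp (ExN (ExO A)) (ExO (ExN A)))"
proof (rule ExN_elim_imp)
  have "oderives T [A] A" using wf by simp
  from ExO_Var[OF ExN_Var[OF this]]
  have "oderives T [] (OImp A (lift_O (lift_N (ExO (ExN A)))))"
    by (simp add: oderives.ImpI)
  then show "oderives T (map lift_N []) (OImp (ExO A) (lift_N (ExO (ExN A))))"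
    by (intro ExO_elim_imp) (use wf in simp_all)
qed (use wf in simp)

lemma ExN_imp_distrib:
  assumes wf: "wf_oform A" "wf_oform B"
  shows "oderives T [] (OImp (ExN (OImp (lift_N A) B)) (OImp A (ExN B)))"
proof (rule ExN_elim_imp)
  let ?\<Gamma> = "[lift_N A, OImp (lift_N A) B]"
  have "oderives T ?\<Gamma> B" by (rule oderives.ImpE[of _ _ "lift_N A"]) (use wf in auto)
  from ExN_Var[OF this]
  show "oderives T (map lift_N []) (OImp (OImp (lift_N A) B) (lift_N (OImp A (ExN B))))"
    by (simp add: oderives.ImpI)
qed (use wf in simp)

section \<open>Interpreting the predicate by a formula\<close>

text \<open>
  Index 0 of \<open>\<Theta>\<close> is the argument place, the higher numeric indices are parameters, as for \<open>psubst\<close>.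
  This is the common generalisation of \<open>hat\<close>, of \<open>interp (In_below k)\<close> and of \<open>hat\<close> after \<open>psubst\<close>, so
  that monotonicity can compare any two of them.
\<close>

primrec plug :: "oform \<Rightarrow> form \<Rightarrow> oform" where
  "plug \<Theta> (Eq s t) = OEq s t"
| "plug \<Theta> (Rel f ts) = ORel f ts"
| "plug \<Theta> (Pred t) = inst_N t \<Theta>"
| "plug \<Theta> (Neg A) = ONeg (plug \<Theta> A)"
| "plug \<Theta> (Con A B) = OCon (plug \<Theta> A) (plug \<Theta> B)"
| "plug \<Theta> (Dis A B) = ODis (plug \<Theta> A) (plug \<Theta> B)"
| "plug \<Theta> (Imp A B) = OImp (plug \<Theta> A) (plug \<Theta> B)"
| "plug \<Theta> (All A) = AllN (plug (osubst (up shift) OVar \<Theta>) A)"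
| "plug \<Theta> (Ex A) = ExN (plug (osubst (up shift) OVar \<Theta>) A)"

definition some_stage :: oform where
  "some_stage = ExO (In (OVar 0) (Var 0))"

text \<open>
  \<open>x \<in> I\<^bsub>\<prec>a\<^esub>\<close> as an argument for \<open>plug\<close>.  Numeric variables of \<open>a\<close> move up by two, past the argument
  \<open>x\<close> and the bound index of the child of \<open>a\<close>.
\<close>

definition below :: "otrm \<Rightarrow> oform" where
  "below a = ExN (In (Sub (subst_otrm (\<lambda>n. Var (n + 2)) OVar a) (Var 0)) (Var 1))"

lemma wf_some_stage [simp]: "wf_oform some_stage"
  by (simp add: some_stage_def)

lemma wf_below [simp]: "wf_otrm a \<Longrightarrow> wf_oform (below a)"
  by (simp add: below_def wf_subst_otrm)

lemma no_tree_quant_below [simp]: "no_tree_quant (below a)"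
  by (simp add: below_def)

lemma osubst_some_stage [simp]: "osubst (up \<sigma>) \<tau> some_stage = some_stage"
  by (simp add: some_stage_def up_def oup_def)

lemma osubst_below [simp]:
  "osubst (up \<sigma>) (nup \<tau>) (below a) = below (subst_otrm \<sigma> \<tau> a)"
  by (auto simp: below_def up_def nup_def subst_otrm_comp subst_trm_comp)

lemma osubst_below_N [simp]: "osubst (up \<sigma>) OVar (below a) = below (subst_otrm \<sigma> OVar a)"
  using osubst_below[of \<sigma> OVar a] by simp

lemma osubst_below_O [simp]: "osubst Var (nup \<tau>) (below a) = below (subst_otrm Var \<tau> a)"
  using osubst_below[of Var \<tau> a] by simp

lemma lift_O_below [simp]: "lift_O (below a) = below (subst_otrm Var oshift a)"
  using osubst_below_O[of oshift a] by simp

lemma osubst_some_stage_O [simp]: "osubst Var \<tau> some_stage = some_stage"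
  using osubst_some_stage[of Var \<tau>] by simp

lemma osubst_plug: "osubst \<sigma> \<tau> (plug \<Theta> A) = plug (osubst (up \<sigma>) (nup \<tau>) \<Theta>) (subst \<sigma> A)"
proof (induction A arbitrary: \<sigma> \<tau> \<Theta>)
  case (Pred t)
  have "osubst \<sigma> \<tau> (inst_N t \<Theta>) = inst_N (subst_trm \<sigma> t) (osubst (up \<sigma>) (nup \<tau>) \<Theta>)"
    unfolding osubst_comp
    by (rule osubst_cong)
      (auto simp: up_def nup_def subst_trm_comp subst_otrm_comp split: nat.splits)
  then show ?case by simp
next
  have *: "osubst (up (up \<sigma>)) (nup (nup \<tau>)) (osubst (up shift) OVar \<Theta>) =
    osubst (up shift) OVar (osubst (up \<sigma>) (nup \<tau>) \<Theta>)" for \<sigma> \<tau> \<Theta>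
    unfolding osubst_comp
    by (rule osubst_cong)
      (auto simp: up_def nup_def subst_trm_comp subst_otrm_comp split: nat.splits)
  case (All A)
  then show ?case by (simp add: *)
  case (Ex A)
  then show ?case by (simp add: *)
qed simp_all

lemma subst_Var [simp]: "subst Var A = A"
  by (induction A) (auto simp: map_idI)

lemma wf_plug: "wf_form A \<Longrightarrow> wf_oform \<Theta> \<Longrightarrow> wf_oform (plug \<Theta> A)"
  by (induction A arbitrary: \<Theta>) (auto simp: wf_inst)

lemma no_tree_quant_plug [simp]: "no_tree_quant \<Theta> \<Longrightarrow> no_tree_quant (plug \<Theta> A)"
  by (induction A arbitrary: \<Theta>) auto

lemma hat_eq_plug: "hat A = plug some_stage A"
proof -
  have "interp (\<lambda>t. ExO (In (OVar 0) t)) A = plug some_stage A"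
    by (induction A) (simp_all, simp add: some_stage_def)
  then show ?thesis by (simp add: hat_def)
qed

lemma interp_In_below: "interp (In_below k) A = plug (below (OVar k)) A"
  by (induction A) (simp_all, simp add: below_def In_below_def up_def nup_def)

lemma hat_simps [simp]:
  "hat (Eq s t) = OEq s t" "hat (Rel f ts) = ORel f ts" "hat (Neg A) = ONeg (hat A)"
  "hat (Con A B) = OCon (hat A) (hat B)" "hat (Dis A B) = ODis (hat A) (hat B)"
  "hat (Imp A B) = OImp (hat A) (hat B)" "hat (All A) = AllN (hat A)" "hat (Ex A) = ExN (hat A)"
  by (simp_all add: hat_def)

lemma hat_Pred_Var [simp]: "hat (Pred (Var 0)) = some_stage"
  by (simp add: hat_def some_stage_def)

lemma wf_hat [simp]: "wf_form A \<Longrightarrow> wf_oform (hat A)"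
  by (simp add: hat_eq_plug wf_plug)

lemma osubst_hat: "osubst \<sigma> \<tau> (hat A) = hat (subst \<sigma> A)"
  by (simp add: hat_eq_plug osubst_plug)

lemma hat_psubst: "hat (psubst \<theta> A) = plug (hat \<theta>) A"
  by (induction A arbitrary: \<theta>) (simp_all add: osubst_hat)

section \<open>Negation normal form\<close>

text \<open>
  Formulas in negation normal form without negated \<open>Pred\<close>, given inductively so that monotonicity and
  reflection can be proved without keeping track of polarities.
\<close>

inductive pos_nnf :: "form \<Rightarrow> bool" where
  Eq: "pos_nnf (Eq s t)"
| Neg_Eq: "pos_nnf (Neg (Eq s t))"
| Rel: "pos_nnf (Rel f ts)"
| Neg_Rel: "pos_nnf (Neg (Rel f ts))"
| Pred: "pos_nnf (Pred t)"
| Con: "pos_nnf A \<Longrightarrow> pos_nnf B \<Longrightarrow> pos_nnf (Con A B)"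
| Dis: "pos_nnf A \<Longrightarrow> pos_nnf B \<Longrightarrow> pos_nnf (Dis A B)"
| All: "pos_nnf A \<Longrightarrow> pos_nnf (All A)"
| Ex: "pos_nnf A \<Longrightarrow> pos_nnf (Ex A)"

lemma pos_nnf_nnf: "\<forall>t. Neg (Pred t) \<notin> subformulas (nnf b A) \<Longrightarrow> pos_nnf (nnf b A)"
  by (induction A arbitrary: b) (auto intro: pos_nnf.intros split: if_splits)

lemma wf_subst: "wf_form A \<Longrightarrow> \<forall>n. wf_trm (\<sigma> n) \<Longrightarrow> wf_form (subst \<sigma> A)"
  by (induction A arbitrary: \<sigma>) auto

lemma pos_nnf_subst: "pos_nnf A \<Longrightarrow> pos_nnf (subst \<sigma> A)"
  by (induction arbitrary: \<sigma> rule: pos_nnf.induct) (auto intro: pos_nnf.intros)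

lemma wf_nnf: "wf_form A \<Longrightarrow> wf_form (nnf b A)"
  by (induction A arbitrary: b) auto

lemma nnf_equivalence:
  assumes "wf_form A" "wf_oform \<Theta>"
  shows "oderives T [] (OIff (plug \<Theta> A) (plug \<Theta> (nnf True A)))"
    and "oderives T [] (OIff (ONeg (plug \<Theta> A)) (plug \<Theta> (nnf False A)))"
  using assms
proof (induction A arbitrary: \<Theta>)
  case (Neg A)
  { case (1 \<Theta>) then show ?case using Neg.IH by simp }
  { case (2 \<Theta>) then show ?case using iff_not_not[OF Neg.IH(1)[of \<Theta>]] by simp }
next
  case (Con A B)
  { case (1 \<Theta>) then show ?case using iff_Con[OF Con.IH(1)[of \<Theta>] Con.IH(3)[of \<Theta>]] by simp }
  { case (2 \<Theta>) then show ?case using iff_not_Con[OF Con.IH(2)[of \<Theta>] Con.IH(4)[of \<Theta>]] by simp }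
next
  case (Dis A B)
  { case (1 \<Theta>) then show ?case using iff_Dis[OF Dis.IH(1)[of \<Theta>] Dis.IH(3)[of \<Theta>]] by simp }
  { case (2 \<Theta>) then show ?case using iff_not_Dis[OF Dis.IH(2)[of \<Theta>] Dis.IH(4)[of \<Theta>]] by simp }
next
  case (Imp A B)
  { case (1 \<Theta>) then show ?case using iff_Imp[OF Imp.IH(2)[of \<Theta>] Imp.IH(3)[of \<Theta>]] by simp }
  { case (2 \<Theta>) then show ?case using iff_not_Imp[OF Imp.IH(1)[of \<Theta>] Imp.IH(4)[of \<Theta>]] by simp }
next
  case (All A)
  { case (1 \<Theta>)
    let ?\<Theta> = "osubst (up shift) OVar \<Theta>"
    from 1 have "oderives T [] (OIff (plug ?\<Theta> A) (plug ?\<Theta> (nnf True A)))"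
      by (intro All.IH) simp_all
    from AllN_iff[OF this] show ?case by simp }
  { case (2 \<Theta>)
    let ?\<Theta> = "osubst (up shift) OVar \<Theta>"
    have "oderives T [] (OIff (ExN (ONeg (plug ?\<Theta> A))) (ExN (plug ?\<Theta> (nnf False A))))"
      using 2 by (intro ExN_iff All.IH) simp_all
    then have "oderives T [] (OIff (ONeg (AllN (plug ?\<Theta> A))) (ExN (plug ?\<Theta> (nnf False A))))"
      using 2 by (intro iff_trans[OF not_AllN]) (simp_all add: wf_plug)
    then show ?case by simp }
next
  case (Ex A)
  { case (1 \<Theta>)
    let ?\<Theta> = "osubst (up shift) OVar \<Theta>"
    from 1 have "oderives T [] (OIff (plug ?\<Theta> A) (plug ?\<Theta> (nnf True A)))"
      by (intro Ex.IH) simp_all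
    from ExN_iff[OF this] show ?case by simp }
  { case (2 \<Theta>)
    let ?\<Theta> = "osubst (up shift) OVar \<Theta>"
    have "oderives T [] (OIff (AllN (ONeg (plug ?\<Theta> A))) (AllN (plug ?\<Theta> (nnf False A))))"
      using 2 by (intro AllN_iff Ex.IH) simp_all
    then have "oderives T [] (OIff (ONeg (ExN (plug ?\<Theta> A))) (AllN (plug ?\<Theta> (nnf False A))))"
      using 2 by (intro iff_trans[OF not_ExN]) (simp_all add: wf_plug)
    then show ?case by simp }
qed (simp_all add: iff_refl wf_inst)

text \<open>
  The inclusion of \<open>\<Theta>\<close> in \<open>\<Theta>'\<close> is a hypothesis and not a derivability assumption: at a quantifier it
  is lifted together with the rest of \<open>\<Gamma>\<close>, which gives exactly the inclusion between the lifted
  interpretations that the induction hypothesis asks for.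
\<close>

lemma pos_nnf_mono:
  assumes "pos_nnf A" "wf_form A"
    and "AllN (OImp \<Theta> \<Theta>') \<in> set \<Gamma>" "wf_context \<Gamma>"
  shows "oderives T \<Gamma> (OImp (plug \<Theta> A) (plug \<Theta>' A))"
  using assms
proof (induction A arbitrary: \<Gamma> \<Theta> \<Theta>' rule: pos_nnf.induct)
  case (Pred t)
  then have "oderives T \<Gamma> (inst_N t (OImp \<Theta> \<Theta>'))"
    by (intro oderives.AllNE) auto
  then show ?case by simp
next
  case (Con A B)
  have "oderives T \<Gamma> (OImp (plug \<Theta> A) (plug \<Theta>' A))"
    and "oderives T \<Gamma> (OImp (plug \<Theta> B) (plug \<Theta>' B))"
    using Con.prems by (auto intro: Con.IH)
  then show ?case by (simp add: imp_Con)
next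
  case (Dis A B)
  have "oderives T \<Gamma> (OImp (plug \<Theta> A) (plug \<Theta>' A))"
    and "oderives T \<Gamma> (OImp (plug \<Theta> B) (plug \<Theta>' B))"
    using Dis.prems by (auto intro: Dis.IH)
  then show ?case by (simp add: imp_Dis)
next
  case (All A)
  let ?L = "osubst (up shift) OVar"
  have "lift_N (AllN (OImp \<Theta> \<Theta>')) \<in> set (map lift_N \<Gamma>)"
    using All.prems(2) unfolding set_map by (rule imageI)
  then have "oderives T (map lift_N \<Gamma>) (OImp (plug (?L \<Theta>) A) (plug (?L \<Theta>') A))"
    using All.prems by (intro All.IH) auto
  then show ?case by (simp add: AllN_imp)
next
  case (Ex A)
  let ?L = "osubst (up shift) OVar"
  have "lift_N (AllN (OImp \<Theta> \<Theta>')) \<in> set (map lift_N \<Gamma>)"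
    using Ex.prems(2) unfolding set_map by (rule imageI)
  then have "oderives T (map lift_N \<Gamma>) (OImp (plug (?L \<Theta>) A) (plug (?L \<Theta>') A))"
    using Ex.prems by (intro Ex.IH) auto
  then show ?case by (simp add: ExN_imp)
qed (simp_all add: imp_refl)

lemma pos_nnf_mono_imp:
  assumes "pos_nnf A" "wf_form A" "oderives T (map lift_N \<Gamma>) (OImp \<Theta> \<Theta>')"
  shows "oderives T \<Gamma> (OImp (plug \<Theta> A) (plug \<Theta>' A))"
proof (rule cut[OF oderives.AllNI[OF assms(3)]])
  show "oderives T (AllN (OImp \<Theta> \<Theta>') # \<Gamma>) (OImp (plug \<Theta> A) (plug \<Theta>' A))"
    using wf_conclusion[OF assms(3)] wf_premises[OF assms(3)] assms
    by (intro pos_nnf_mono) auto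
qed

lemma plug_below_lift_O [simp]:
  "lift_O (plug (below (OVar k)) A) = plug (below (OVar (Suc k))) A"
  "osubst Var (oup oshift) (plug (below (OVar 0)) A) = plug (below (OVar 0)) A"
  by (simp_all add: osubst_plug oup_def)

section \<open>Reflection of positive formulas to a stage\<close>

abbreviation oid1 :: "form \<Rightarrow> oform set" where
  "oid1 \<psi> \<equiv> insert nontrivial_tree (oid1_axioms \<psi>)"

lemma oid1_axiom:
  "A \<in> oid1_axioms \<psi> \<Longrightarrow> wf_oform A \<Longrightarrow> wf_context \<Gamma> \<Longrightarrow> oderives (oid1 \<psi>) \<Gamma> A"
  by (rule oderives.Ax) auto

lemma bounding_rule:
  assumes "oderives (oid1 \<psi>) \<Gamma> (AllN (ExO A))" "no_tree_quant A"
  shows "oderives (oid1 \<psi>) \<Gamma> (ExO (AllN (ExN (at_child A))))"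
proof (rule oderives.ImpE[OF oid1_axiom assms(1)])
  have wf: "wf_oform A" using wf_conclusion[OF assms(1)] by simp
  then show "OImp (AllN (ExO A)) (ExO (AllN (ExN (at_child A)))) \<in> oid1_axioms \<psi>"
    using assms(2) by (rule oid1_axioms.bounding)
  show "wf_oform (OImp (AllN (ExO A)) (ExO (AllN (ExN (at_child A)))))"
    using wf by (auto simp: at_child_def intro!: wf_osubst split: nat.splits)
  show "wf_context \<Gamma>" using wf_premises[OF assms(1)] .
qed

text \<open>
  Bounding applied to \<open>Q(x) \<longrightarrow> x \<in> I\<^bsub>\<alpha>\<^esub>\<close>, which contains no tree quantifier although \<open>Q \<subseteq> J\<close> does.  For
  given \<open>x\<close> a suitable \<open>\<alpha>\<close> exists classically: either \<open>Q(x)\<close> fails and any tree will do, or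
  \<open>x \<in> I\<^bsub>\<alpha>\<^esub>\<close> for some \<open>\<alpha>\<close>.  In the conclusion \<open>Q\<close> does not depend on the index of the child, so
  the existential quantifier over it moves past \<open>Q\<close>.
\<close>

lemma stage_bound:
  assumes Q: "no_tree_quant Q" "oderives (oid1 \<psi>) (map lift_N \<Gamma>) (OImp Q some_stage)"
  shows "oderives (oid1 \<psi>) \<Gamma> (ExO (AllN (OImp (lift_O Q) (below (OVar 0)))))"
proof -
  let ?A = "OImp (lift_O Q) (In (OVar 0) (Var 0))"
  let ?\<Delta> = "map lift_N \<Gamma>"
  have wf: "wf_oform Q" "wf_context ?\<Delta>"
    using wf_conclusion[OF Q(2)] wf_premises[OF Q(2)] by auto
  have "oderives (oid1 \<psi>) ?\<Delta> (ExO ?A)"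
  proof (rule case_distinction)
    have "oderives (oid1 \<psi>) (Q # ?\<Delta>) some_stage"
      by (rule oderives.ImpE[OF weakening[OF Q(2)]]) (use wf in auto)
    moreover have "oderives (oid1 \<psi>) (In (OVar 0) (Var 0) # map lift_O (Q # ?\<Delta>)) ?A"
      by (rule oderives.ImpI) (use wf in auto)
    from ExO_Var[OF this]
    have "oderives (oid1 \<psi>) (In (OVar 0) (Var 0) # map lift_O (Q # ?\<Delta>)) (lift_O (ExO ?A))"
      by simp
    ultimately show "oderives (oid1 \<psi>) (Q # ?\<Delta>) (ExO ?A)"
      unfolding some_stage_def by (rule oderives.ExOE) (use wf in auto)
  next
    let ?\<Gamma> = "ONeg Q # ?\<Delta>"
    have neg: "oderives (oid1 \<psi>) ?\<Gamma> (ONeg Q)" using wf by simp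
    have "inst_O (OVar 0) (lift_O Q) = osubst Var OVar Q"
      unfolding osubst_comp by (rule osubst_cong) auto
    moreover have "oderives (oid1 \<psi>) ?\<Gamma> (OImp Q (In (OVar 0) (Var 0)))"
      by (rule consequence[OF neg neg]) (use wf in auto)
    ultimately have "oderives (oid1 \<psi>) ?\<Gamma> (inst_O (OVar 0) ?A)" by simp
    then show "oderives (oid1 \<psi>) ?\<Gamma> (ExO ?A)"
      by (rule oderives.ExOI) (use wf in auto)
  qed
  then have "oderives (oid1 \<psi>) \<Gamma> (ExO (AllN (ExN (at_child ?A))))"
    using Q(1) by (intro bounding_rule oderives.AllNI) auto
  moreover have "oderives (oid1 \<psi>) \<Gamma>
    (OImp (ExO (AllN (ExN (at_child ?A)))) (ExO (AllN (OImp (lift_O Q) (below (OVar 0))))))"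
  proof (intro ExO_imp AllN_imp)
    have child: "at_child ?A = OImp (lift_N (lift_O Q)) (In (Sub (OVar 0) (Var 0)) (Var 1))"
      unfolding at_child_def osubst.simps osubst_comp by (auto intro!: osubst_cong)
    have below: "below (OVar 0) = ExN (In (Sub (OVar 0) (Var 0)) (Var 1))"
      by (simp add: below_def)
    show "oderives (oid1 \<psi>) (map lift_N (map lift_O \<Gamma>))
        (OImp (ExN (at_child ?A)) (OImp (lift_O Q) (below (OVar 0))))"
      unfolding child below by (rule from_theorem[OF ExN_imp_distrib]) (use wf in auto)
  qed
  ultimately show ?thesis by (rule oderives.ImpE[rotated])
qed

text \<open>
  By \<open>stage_bound\<close> and monotonicity, it suffices for reflection to find some tree-quantifier-free
  \<open>Q \<subseteq> J\<close> of which the formula is true.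
\<close>

lemma reflection_step:
  assumes A: "pos_nnf A" "wf_form A"
    and Q: "no_tree_quant Q" "oderives (oid1 \<psi>) (map lift_N \<Gamma>) (OImp Q some_stage)"
    and "oderives (oid1 \<psi>) \<Gamma> (plug Q A)"
  shows "oderives (oid1 \<psi>) \<Gamma> (ExO (plug (below (OVar 0)) A))"
proof (rule cut[OF assms(5)])
  let ?B = "AllN (OImp (lift_O Q) (below (OVar 0)))"
  let ?\<Gamma> = "?B # map lift_O (plug Q A # \<Gamma>)"
  have wf: "wf_oform Q" "wf_context \<Gamma>" "wf_oform (plug Q A)"
    using wf_conclusion[OF Q(2)] wf_premises[OF Q(2)] wf_conclusion[OF assms(5)] by auto
  have "oderives (oid1 \<psi>) ?\<Gamma> (OImp (plug (lift_O Q) A) (plug (below (OVar 0)) A))"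
    by (rule pos_nnf_mono) (use A wf in auto)
  moreover have "oderives (oid1 \<psi>) ?\<Gamma> (plug (lift_O Q) A)"
    using wf A by (auto simp: osubst_plug wf_plug)
  ultimately have "oderives (oid1 \<psi>) ?\<Gamma> (plug (below (OVar 0)) A)" by (rule oderives.ImpE)
  from ExO_Var[OF this]
  have 2: "oderives (oid1 \<psi>) ?\<Gamma> (lift_O (ExO (plug (below (OVar 0)) A)))" by simp
  have 1: "oderives (oid1 \<psi>) (plug Q A # \<Gamma>) (ExO ?B)"
    by (rule weakening[OF stage_bound[OF Q]]) (use wf in auto)
  show "oderives (oid1 \<psi>) (plug Q A # \<Gamma>) (ExO (plug (below (OVar 0)) A))"
    using A by (intro oderives.ExOE[OF 1 2]) (simp add: wf_plug)
qed

lemma below_imp_some_stage: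
  assumes "wf_otrm a"
  shows "oderives T [] (OImp (below a) some_stage)"
  unfolding below_def
proof (rule ExN_elim_imp)
  let ?a = "Sub (subst_otrm (\<lambda>n. Var (n + 2)) OVar a) (Var 0)"
  have "oderives T [In ?a (Var 1)] (ExO (In (OVar 0) (Var 1)))"
    by (rule oderives.ExOI[of _ _ ?a]) (use assms in \<open>auto intro: wf_subst_otrm\<close>)
  then show "oderives T (map lift_N []) (OImp (In ?a (Var 1)) (lift_N some_stage))"
    by (simp add: some_stage_def oderives.ImpI)
qed simp

text \<open>
  Each case chooses the set \<open>Q\<close> for \<open>reflection_step\<close>: for an atom \<open>t \<in> J\<close> the stage \<open>I\<^bsub>\<alpha>\<^esub>\<close> that
  contains \<open>t\<close>, for a conjunction the union \<open>I\<^bsub>\<prec>\<alpha>\<^esub> \<union> I\<^bsub>\<prec>\<beta>\<^esub>\<close> for the trees of the two conjuncts, and for a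
  universal quantifier \<open>\<Union>\<^sub>i I\<^bsub>\<prec>\<gamma>[i]\<^esub>\<close> with \<open>\<gamma>\<close> from the bounding axiom.  For a disjunction or an
  existential quantifier the tree of the true instance still works, and for a literal without the
  predicate any tree does.
\<close>

lemma pos_nnf_reflection:
  assumes "pos_nnf A" "wf_form A"
  shows "oderives (oid1 \<psi>) [] (OImp (plug some_stage A) (ExO (plug (below (OVar 0)) A)))"
  using assms
proof (induction A rule: pos_nnf.induct)
  case (Pred t)
  let ?Q = "In (OVar 0) (Var 0)"
  let ?C = "ExO (plug (below (OVar 0)) (Pred t))"
  have "oderives (oid1 \<psi>) [?Q] some_stage"
    unfolding some_stage_def by (rule oderives.ExOI[of _ _ "OVar 0"]) auto
  then have "oderives (oid1 \<psi>) (map lift_N [In (OVar 0) t]) (OImp ?Q some_stage)"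
    by (rule from_theorem[OF oderives.ImpI]) (use Pred in simp)
  then have C: "oderives (oid1 \<psi>) [In (OVar 0) t] ?C"
    by (rule reflection_step[rotated 3]) (use Pred in \<open>auto intro: pos_nnf.intros\<close>)
  have lift_C: "lift_O ?C = ?C"
    using plug_below_lift_O(2)[of "Pred t"] by simp
  have "oderives (oid1 \<psi>) (In (OVar 0) t # map lift_O [ExO (In (OVar 0) t)]) (lift_O ?C)"
    unfolding lift_C by (rule weakening[OF C]) (use Pred in auto)
  then have "oderives (oid1 \<psi>) [ExO (In (OVar 0) t)] ?C"
    by (rule oderives.ExOE[of _ _ "In (OVar 0) t", rotated]) (use Pred in \<open>auto intro!: wf_osubst split: nat.splits\<close>)
  then show ?case by (auto intro: oderives.ImpI simp: some_stage_def)
next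
  case (Con A B)
  let ?F = "\<lambda>k. plug (below (OVar k))"
  let ?X = "plug some_stage (Con A B)"
  let ?Q = "ODis (below (OVar 0)) (below (OVar 1))"
  let ?C = "ExO (?F 0 (Con A B))"
  let ?\<Gamma>1 = "[?F 0 A, ?X]" and ?\<Gamma>2 = "[?F 0 B, ?F 1 A, ?X]"
  have pos: "pos_nnf A" "pos_nnf B" "wf_form A" "wf_form B" using Con by auto
  note wf = wf_plug[OF pos(3)] wf_plug[OF pos(4)]
  have lift_C: "lift_O ?C = ?C" using plug_below_lift_O(2)[of "Con A B"] by simp
  have "oderives (oid1 \<psi>) ?\<Gamma>2 (plug ?Q (Con A B))"
  proof -
    have "oderives (oid1 \<psi>) (map lift_N ?\<Gamma>2) (OImp (below (OVar 1)) ?Q)"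
      "oderives (oid1 \<psi>) (map lift_N ?\<Gamma>2) (OImp (below (OVar 0)) ?Q)"
      by (rule propositional_completeness; use wf in simp)+
    then have mono: "oderives (oid1 \<psi>) ?\<Gamma>2 (OImp (?F 1 A) (plug ?Q A))"
      "oderives (oid1 \<psi>) ?\<Gamma>2 (OImp (?F 0 B) (plug ?Q B))"
      by (intro pos_nnf_mono_imp pos; simp)+
    have "oderives (oid1 \<psi>) ?\<Gamma>2 (plug ?Q A)"
      by (rule oderives.ImpE[OF mono(1)]) (use wf in simp)
    moreover have "oderives (oid1 \<psi>) ?\<Gamma>2 (plug ?Q B)"
      by (rule oderives.ImpE[OF mono(2)]) (use wf in simp)
    ultimately show ?thesis by (simp add: oderives.ConI)
  qed
  moreover have "oderives (oid1 \<psi>) (map lift_N ?\<Gamma>2) (OImp ?Q some_stage)"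
  proof -
    have "oderives (oid1 \<psi>) (map lift_N ?\<Gamma>2) (OImp (below (OVar 0)) some_stage)"
      "oderives (oid1 \<psi>) (map lift_N ?\<Gamma>2) (OImp (below (OVar 1)) some_stage)"
      by (rule from_theorem[OF below_imp_some_stage]; use wf in simp)+
    then show ?thesis by (rule consequence) auto
  qed
  ultimately have "oderives (oid1 \<psi>) ?\<Gamma>2 ?C"
    by (intro reflection_step[of _ ?Q]) (use Con in \<open>auto intro: pos_nnf.intros\<close>)
  then have 2: "oderives (oid1 \<psi>) (?F 0 B # map lift_O ?\<Gamma>1) (lift_O ?C)"
    unfolding lift_C by (simp add: osubst_plug)
  have "oderives (oid1 \<psi>) ?\<Gamma>1 (plug some_stage B)"
    by (rule oderives.ConE2[of _ _ "plug some_stage A"]) (use wf in simp)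
  then have "oderives (oid1 \<psi>) ?\<Gamma>1 (ExO (?F 0 B))"
    by (rule apply_theorem) (rule Con.IH(2)[OF pos(4)])
  from oderives.ExOE[OF this 2] have "oderives (oid1 \<psi>) ?\<Gamma>1 ?C" using wf by simp
  then have 1: "oderives (oid1 \<psi>) (?F 0 A # map lift_O [?X]) (lift_O ?C)"
    unfolding lift_C by (simp add: osubst_plug)
  have "oderives (oid1 \<psi>) [?X] (plug some_stage A)"
    by (rule oderives.ConE1[of _ _ _ "plug some_stage B"]) (use wf in simp)
  then have "oderives (oid1 \<psi>) [?X] (ExO (?F 0 A))"
    by (rule apply_theorem) (rule Con.IH(1)[OF pos(3)])
  from oderives.ExOE[OF this 1] have "oderives (oid1 \<psi>) [?X] ?C" using wf by simp
  then show ?case by (rule oderives.ImpI)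
next
  case (Dis A B)
  let ?F = "plug (below (OVar 0))"
  have wf: "wf_oform (?F A)" "wf_oform (?F B)" using Dis.prems by (auto simp: wf_plug)
  have "oderives (oid1 \<psi>) [] (OImp (ExO (?F A)) (ExO (?F (Dis A B))))"
    "oderives (oid1 \<psi>) [] (OImp (ExO (?F B)) (ExO (?F (Dis A B))))"
    by (intro ExO_imp propositional_completeness; use wf in simp)+
  then have "oderives (oid1 \<psi>) [] (OImp (plug some_stage A) (ExO (?F (Dis A B))))"
    "oderives (oid1 \<psi>) [] (OImp (plug some_stage B) (ExO (?F (Dis A B))))"
    using Dis by (auto intro: imp_trans)
  then show ?case by (rule consequence) (use Dis.prems wf in \<open>auto simp: wf_plug\<close>)
next
  case (All A)
  let ?F = "plug (below (OVar 0)) A"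
  let ?X = "AllN (plug some_stage A)"
  let ?\<beta> = "Sub (OVar 0) (Var 0)"
  let ?Q = "ExN (ExN (In (Sub (Sub (OVar 0) (Var 1)) (Var 0)) (Var 2)))"
  let ?C = "ExO (plug (below (OVar 0)) (All A))"
  let ?B = "AllN (ExN (at_child ?F))"
  let ?\<Gamma> = "[?B, ?X]"
  have pos: "pos_nnf A" "wf_form A" using All by auto
  note wf = wf_plug[OF pos(2)]
  have lift_C: "lift_O ?C = ?C" using plug_below_lift_O(2)[of "All A"] by simp
  have child: "at_child ?F = plug (below ?\<beta>) (subst shift A)"
    unfolding at_child_def osubst_plug by (simp add: below_def up_def nup_def)
  have wf_child: "wf_oform (at_child ?F)" unfolding at_child_def
    by (rule wf_osubst) (use wf in \<open>auto split: nat.splits\<close>)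
  have "oderives (oid1 \<psi>) [?X] (AllN (ExO ?F))"
    by (rule oderives.ImpE[OF from_theorem[OF AllN_imp]]) (use All wf in auto)
  then have bounded: "oderives (oid1 \<psi>) [?X] (ExO ?B)" by (rule bounding_rule) simp
  \<comment> \<open>\<open>?Q\<close> contains the union of the stages below each child of \<open>\<gamma>\<close>, whichever child serves the instance.\<close>
  have Q: "oderives (oid1 \<psi>) [] (OImp (ExN (at_child ?F)) (plug ?Q A))"
  proof -
    have "oderives (oid1 \<psi>) [below ?\<beta>] ?Q"
      by (rule oderives.ExNI[of _ _ "Var 1"]) (auto simp: below_def up_def nup_def)
    then have "oderives (oid1 \<psi>) [] (OImp (at_child ?F) (plug ?Q (subst shift A)))"
      unfolding child
      by (intro pos_nnf_mono_imp) (use pos in \<open>auto intro: pos_nnf_subst wf_subst oderives.ImpI\<close>)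
    moreover have "lift_N (plug ?Q A) = plug ?Q (subst shift A)"
      by (simp add: osubst_plug up_def numeral_2_eq_2)
    ultimately have "oderives (oid1 \<psi>) [] (OImp (at_child ?F) (lift_N (plug ?Q A)))"
      by (simp only:)
    then show ?thesis by (intro ExN_elim_imp) (use wf in simp_all)
  qed
  have "oderives (oid1 \<psi>) ?\<Gamma> (AllN (plug ?Q A))"
    by (rule oderives.ImpE[OF from_theorem[OF AllN_imp]]) (use Q wf wf_child in auto)
  then have "oderives (oid1 \<psi>) ?\<Gamma> (plug ?Q (All A))" by (simp add: up_def numeral_2_eq_2)
  moreover have "oderives (oid1 \<psi>) (map lift_N ?\<Gamma>) (OImp ?Q some_stage)"
  proof (rule from_theorem)
    let ?a = "Sub (Sub (OVar 0) (Var 1)) (Var 0)"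
    have "oderives (oid1 \<psi>) [In ?a (Var 2)] (ExO (In (OVar 0) (Var 2)))"
      by (rule oderives.ExOI[of _ _ ?a]) auto
    then have "oderives (oid1 \<psi>) [] (OImp (In ?a (Var 2)) (lift_N (lift_N some_stage)))"
      by (simp add: some_stage_def oderives.ImpI numeral_2_eq_2)
    then show "oderives (oid1 \<psi>) [] (OImp ?Q some_stage)"
      by (intro ExN_elim_imp) simp_all
  qed (use wf wf_child in simp)
  ultimately have "oderives (oid1 \<psi>) ?\<Gamma> ?C"
    by (intro reflection_step[of _ ?Q]) (use All in \<open>auto intro: pos_nnf.intros\<close>)
  then have "oderives (oid1 \<psi>) (?B # map lift_O [?X]) (lift_O ?C)"
    unfolding lift_C by (simp add: osubst_plug)
  from oderives.ExOE[OF bounded this] have "oderives (oid1 \<psi>) [?X] ?C" using wf by simp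
  then show ?case by (intro oderives.ImpI) simp
next
  case (Ex A)
  have "oderives (oid1 \<psi>) []
    (OImp (ExN (plug some_stage A)) (ExN (ExO (plug (below (OVar 0)) A))))"
    using Ex by (intro ExN_imp) simp
  then have "oderives (oid1 \<psi>) []
    (OImp (ExN (plug some_stage A)) (ExO (ExN (plug (below (OVar 0)) A))))"
    by (rule imp_trans) (use Ex in \<open>auto intro: ExN_ExO_swap simp: wf_plug\<close>)
  then show ?case by simp
qed (intro oderives.ImpI oderives.ExOI[of _ _ "OVar 0"]; simp add: map_idI)+

section \<open>The axioms on the inductive predicate\<close>

lemma positive_mono:
  assumes "positive A" "wf_form A" "AllN (OImp \<Theta> \<Theta>') \<in> set \<Gamma>" "wf_context \<Gamma>"
  shows "oderives T \<Gamma> (OImp (plug \<Theta> A) (plug \<Theta>' A))"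
proof -
  have wf: "wf_oform \<Theta>" "wf_oform \<Theta>'" using bspec[OF assms(4,3)] by auto
  have nnf: "oderives T \<Gamma> (OImp (plug \<Theta> (nnf True A)) (plug \<Theta>' (nnf True A)))"
    using assms by (intro pos_nnf_mono pos_nnf_nnf wf_nnf) (auto simp: positive_def)
  have "oderives T \<Gamma> (OImp (plug \<Theta> A) (plug \<Theta> (nnf True A)))"
    by (rule from_theorem[OF oderives.ConE1[OF nnf_equivalence(1)[OF assms(2) wf(1)]] assms(4)])
  from imp_trans[OF this nnf]
  have "oderives T \<Gamma> (OImp (plug \<Theta> A) (plug \<Theta>' (nnf True A)))" .
  moreover have "oderives T \<Gamma> (OImp (plug \<Theta>' (nnf True A)) (plug \<Theta>' A))"
    by (rule from_theorem[OF oderives.ConE2[OF nnf_equivalence(1)[OF assms(2) wf(2)]] assms(4)])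
  ultimately show ?thesis by (rule imp_trans)
qed

lemma positive_mono_imp:
  assumes "positive A" "wf_form A" "oderives T (map lift_N \<Gamma>) (OImp \<Theta> \<Theta>')"
  shows "oderives T \<Gamma> (OImp (plug \<Theta> A) (plug \<Theta>' A))"
proof (rule cut[OF oderives.AllNI[OF assms(3)]])
  show "oderives T (AllN (OImp \<Theta> \<Theta>') # \<Gamma>) (OImp (plug \<Theta> A) (plug \<Theta>' A))"
    using wf_conclusion[OF assms(3)] wf_premises[OF assms(3)] assms
    by (intro positive_mono) auto
qed

lemma positive_reflection:
  assumes "positive A" "wf_form A"
  shows "oderives (oid1 \<psi>) [] (OImp (plug some_stage A) (ExO (plug (below (OVar 0)) A)))"
proof -
  have "pos_nnf (nnf True A)" using assms(1) by (intro pos_nnf_nnf) (simp add: positive_def)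
  note imp_trans[OF oderives.ConE1[OF nnf_equivalence(1)] pos_nnf_reflection[OF this]]
  then have "oderives (oid1 \<psi>) []
      (OImp (plug some_stage A) (ExO (plug (below (OVar 0)) (nnf True A))))"
    using assms(2) by (simp add: wf_nnf)
  moreover have "oderives (oid1 \<psi>) []
    (OImp (ExO (plug (below (OVar 0)) (nnf True A))) (ExO (plug (below (OVar 0)) A)))"
    by (rule ExO_imp, unfold list.map, rule oderives.ConE2[OF nnf_equivalence(1)]) (use assms(2) in simp_all)
  ultimately show ?thesis by (rule imp_trans)
qed

lemma child_of_e:
  assumes "oderives (oid1 \<psi>) \<Gamma> (IsE a)" "wf_trm t"
  shows "oderives (oid1 \<psi>) \<Gamma> (IsE (Sub a t))"
proof -
  have wf: "wf_otrm a" "wf_context \<Gamma>" using wf_conclusion[OF assms(1)] wf_premises[OF assms(1)] by auto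
  have "oderives (oid1 \<psi>) [] (OImp (IsE (OVar 0)) (IsE (Sub (OVar 0) (Var 0))))"
    by (rule oid1_axiom[OF oid1_axioms.child_e]) auto
  then have "oderives (oid1 \<psi>) [] (AllN (AllO (OImp (IsE (OVar 0)) (IsE (Sub (OVar 0) (Var 0))))))"
    by (intro oderives.AllNI oderives.AllOI) simp
  from from_theorem[OF this wf(2)]
  have "oderives (oid1 \<psi>) \<Gamma> (AllN (AllO (OImp (IsE (OVar 0)) (IsE (Sub (OVar 0) (Var 0))))))" .
  from oderives.AllNE[OF this assms(2)]
  have "oderives (oid1 \<psi>) \<Gamma> (AllO (OImp (IsE (OVar 0)) (IsE (Sub (OVar 0) t))))" by simp
  from oderives.AllOE[OF this wf(1)]
  have "oderives (oid1 \<psi>) \<Gamma> (OImp (IsE a) (IsE (Sub a t)))" by simp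
  then show ?thesis using assms(1) by (rule oderives.ImpE)
qed

lemma stage_of_e:
  assumes "oderives (oid1 \<psi>) \<Gamma> (IsE a)" "wf_trm t"
  shows "oderives (oid1 \<psi>) \<Gamma> (ONeg (In a t))"
proof -
  have wf: "wf_otrm a" "wf_context \<Gamma>" using wf_conclusion[OF assms(1)] wf_premises[OF assms(1)] by auto
  have "oderives (oid1 \<psi>) [] (OImp (IsE (OVar 0)) (AllN (ONeg (In (OVar 0) (Var 0)))))"
    by (rule oid1_axiom[OF oid1_axioms.stage_e]) auto
  then have "oderives (oid1 \<psi>) [] (AllO (OImp (IsE (OVar 0)) (AllN (ONeg (In (OVar 0) (Var 0))))))"
    by (intro oderives.AllOI) simp
  from from_theorem[OF this wf(2)]
  have "oderives (oid1 \<psi>) \<Gamma> (AllO (OImp (IsE (OVar 0)) (AllN (ONeg (In (OVar 0) (Var 0))))))" .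
  from oderives.AllOE[OF this wf(1)]
  have "oderives (oid1 \<psi>) \<Gamma> (OImp (IsE a) (AllN (ONeg (In (subst_otrm shift OVar a) (Var 0)))))"
    by (simp add: nup_def)
  from oderives.AllNE[OF oderives.ImpE[OF this assms(1)] assms(2)]
  show ?thesis by (simp add: subst_otrm_comp)
qed

lemma below_e:
  "oderives (oid1 \<psi>) [] (OImp (IsE (OVar k)) (ONeg (below (OVar k))))"
proof (rule oderives.ImpI)
  let ?A = "In (Sub (OVar k) (Var 0)) (Var 1)"
  have "oderives (oid1 \<psi>) [IsE (OVar k)] (AllN (ONeg ?A))"
    by (rule oderives.AllNI, rule stage_of_e, rule child_of_e) auto
  moreover have "oderives (oid1 \<psi>) [] (OImp (AllN (ONeg ?A)) (ONeg (ExN ?A)))"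
    by (rule oderives.ConE2[OF not_ExN]) simp
  ultimately have "oderives (oid1 \<psi>) [IsE (OVar k)] (ONeg (ExN ?A))" by (rule apply_theorem)
  then show "oderives (oid1 \<psi>) [IsE (OVar k)] (ONeg (below (OVar k)))"
    by (simp add: below_def)
qed

text \<open>
  The stage axiom quantifies over \<open>x\<close>.  Instantiating it with the current variable 0 leaves \<open>\<psi>\<close> as it
  is only because no other variable is free in \<open>\<psi>\<close>.
\<close>

lemma subst_trm_fv: "\<forall>n \<in> fv_trm t. \<sigma> n = Var n \<Longrightarrow> subst_trm \<sigma> t = t"
  by (induction t) (auto intro: map_idI)

lemma subst_fv: "\<forall>n \<in> fv A. \<sigma> n = Var n \<Longrightarrow> subst \<sigma> A = A"
proof (induction A arbitrary: \<sigma>)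
  case (All A)
  have "\<forall>n \<in> fv A. up \<sigma> n = Var n" using All.prems by (auto simp: up_def split: nat.splits)
  then show ?case by (simp add: All.IH)
next
  case (Ex A)
  have "\<forall>n \<in> fv A. up \<sigma> n = Var n" using Ex.prems by (auto simp: up_def split: nat.splits)
  then show ?case by (simp add: Ex.IH)
qed (auto intro: map_idI simp: subst_trm_fv)

lemma stage_iff:
  assumes "wf_form \<psi>" "fv \<psi> \<subseteq> {0}" "oderives (oid1 \<psi>) \<Gamma> (ONeg (IsE (OVar k)))"
  shows "oderives (oid1 \<psi>) \<Gamma> (OIff (In (OVar k) (Var 0)) (plug (below (OVar k)) \<psi>))"
proof -
  let ?B = "\<lambda>k. OIff (In (OVar k) (Var 0)) (plug (below (OVar k)) \<psi>)"
  have "oderives (oid1 \<psi>) \<Gamma> (AllO (OImp (ONeg (IsE (OVar 0))) (AllN (?B 0))))"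
    using oid1_axioms.stage[of \<psi>] assms wf_premises[OF assms(3)]
    by (intro oid1_axiom) (auto simp: interp_In_below wf_plug)
  note all = oderives.AllOE[OF this, of "OVar k"]
  have "nup (case_nat (OVar k) OVar) = case_nat (OVar k) OVar"
    by (rule ext) (simp add: nup_def split: nat.splits)
  then have "osubst Var (case_nat (OVar k) OVar) (below (OVar 0)) = below (OVar k)"
    and "nup (case_nat (OVar k) OVar) = case_nat (OVar k) OVar"
    using osubst_below_O[of "case_nat (OVar k) OVar" "OVar 0"] by simp_all
  then have "oderives (oid1 \<psi>) \<Gamma> (OImp (ONeg (IsE (OVar k))) (AllN (?B k)))"
    using all by (simp add: osubst_plug)
  from oderives.AllNE[OF oderives.ImpE[OF this assms(3)], of "Var 0"]
  have "oderives (oid1 \<psi>) \<Gamma> (OIff (In (OVar k) (Var 0)) (plug (below (OVar k)) (inst (Var 0) \<psi>)))"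
    by (simp add: osubst_plug)
  moreover have "inst (Var 0) \<psi> = \<psi>" by (rule subst_fv) (use assms(2) in auto)
  ultimately show ?thesis by simp
qed

text \<open>
  Reflection gives a tree, here with index 1, such that \<open>\<psi>\<close> holds of the union of the stages of its
  children.  The stage axiom applies to it unless it is \<open>e\<close>; in that case the nontrivial tree, with
  index 0, takes its place by monotonicity.
\<close>

lemma closure_provable:
  assumes "wf_form \<psi>" "fv \<psi> \<subseteq> {0}" "positive \<psi>"
  shows "oderives (oid1 \<psi>) [] (AllN (OImp (plug some_stage \<psi>) some_stage))"
proof (rule oderives.AllNI)
  let ?F = "\<lambda>k. plug (below (OVar k)) \<psi>"
  let ?\<Gamma> = "[ONeg (IsE (OVar 0)), ?F 1]"
  note wf = wf_plug[OF assms(1)]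
  have stage_reached: "oderives (oid1 \<psi>) \<Delta> some_stage"
    if "oderives (oid1 \<psi>) \<Delta> (ONeg (IsE (OVar k)))" "oderives (oid1 \<psi>) \<Delta> (?F k)" for \<Delta> k
  proof -
    have "oderives (oid1 \<psi>) \<Delta> (In (OVar k) (Var 0))"
      by (rule oderives.ImpE[OF oderives.ConE2[OF stage_iff[OF assms(1,2) that(1)]] that(2)])
    then show ?thesis unfolding some_stage_def by (intro oderives.ExOI[of _ _ "OVar k"]) simp_all
  qed
  have "oderives (oid1 \<psi>) ?\<Gamma> some_stage"
  proof (rule case_distinction)
    let ?\<Delta> = "IsE (OVar 1) # ?\<Gamma>"
    have "oderives (oid1 \<psi>) (map lift_N ?\<Delta>) (IsE (OVar 1))"
      using wf by simp
    then have empty: "oderives (oid1 \<psi>) (map lift_N ?\<Delta>) (ONeg (below (OVar 1)))"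
      by (rule apply_theorem) (rule below_e)
    have "oderives (oid1 \<psi>) (map lift_N ?\<Delta>) (OImp (below (OVar 1)) (below (OVar 0)))"
      by (rule consequence[OF empty empty]) auto
    then have "oderives (oid1 \<psi>) ?\<Delta> (OImp (?F 1) (?F 0))"
      by (rule positive_mono_imp[OF assms(3,1)])
    then have "oderives (oid1 \<psi>) ?\<Delta> (?F 0)" by (rule oderives.ImpE) (use wf in simp)
    moreover have "oderives (oid1 \<psi>) ?\<Delta> (ONeg (IsE (OVar 0)))" using wf by simp
    ultimately show "oderives (oid1 \<psi>) ?\<Delta> some_stage" by (intro stage_reached)
  next
    show "oderives (oid1 \<psi>) (ONeg (IsE (OVar 1)) # ?\<Gamma>) some_stage"
      by (rule stage_reached[of _ 1]) (use wf in simp_all)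
  qed
  then have stage: "oderives (oid1 \<psi>) (ONeg (IsE (OVar 0)) # map lift_O [?F 0]) (lift_O some_stage)"
    by simp
  have nontrivial: "oderives (oid1 \<psi>) [?F 0] (ExO (ONeg (IsE (OVar 0))))"
    by (rule oderives.Ax) (use wf in \<open>auto simp: nontrivial_tree_def\<close>)
  have "oderives (oid1 \<psi>) [?F 0] some_stage" by (rule oderives.ExOE[OF nontrivial stage]) simp
  then have "oderives (oid1 \<psi>) [] (OImp (ExO (?F 0)) some_stage)"
    by (intro ExO_elim_imp oderives.ImpI) simp_all
  from imp_trans[OF positive_reflection[OF assms(3,1)] this]
  show "oderives (oid1 \<psi>) (map lift_N []) (OImp (plug some_stage \<psi>) some_stage)" by simp
qed

lemma osubst_hat_O [simp]: "osubst Var \<tau> (hat A) = hat A"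
  by (simp add: osubst_hat)

text \<open>
  Induction on trees for \<open>\<forall>x. x \<in> I\<^bsub>\<alpha>\<^esub> \<longrightarrow> \<theta>(x)\<close>.
\<close>

lemma least_provable:
  assumes "wf_form \<psi>" "fv \<psi> \<subseteq> {0}" "positive \<psi>" "wf_form \<theta>"
  shows "oderives (oid1 \<psi>) []
    (OImp (AllN (OImp (plug (hat (lift_param \<theta>)) \<psi>) (hat \<theta>))) (AllN (OImp some_stage (hat \<theta>))))"
proof (rule oderives.ImpI)
  let ?\<theta> = "hat \<theta>" and ?\<theta>' = "hat (lift_param \<theta>)"
  let ?H = "AllN (OImp (plug ?\<theta>' \<psi>) ?\<theta>)"
  let ?A = "AllN (OImp (In (OVar 0) (Var 0)) ?\<theta>)"
  have wf_\<theta>': "wf_form (lift_param \<theta>)" using assms(4) by (simp add: wf_subst)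
  have wf: "wf_oform ?\<theta>" "wf_oform ?\<theta>'" "wf_oform ?H" "wf_oform ?A"
    using assms(1,4) wf_\<theta>' by (auto intro: wf_plug)
  have lift_H: "lift_O ?H = ?H" by (simp add: osubst_plug)
  have lift_\<theta>: "osubst (up shift) OVar ?\<theta> = ?\<theta>'" by (simp add: osubst_hat)
  have child: "at_child ?A = AllN (OImp (In (Sub (OVar 0) (Var 1)) (Var 0)) ?\<theta>')"
    by (simp add: at_child_def osubst_hat nup_def up_def)
  have base: "oderives (oid1 \<psi>) [?H] (AllO (OImp (IsE (OVar 0)) ?A))"
  proof (rule oderives.AllOI, rule oderives.ImpI, rule oderives.AllNI)
    let ?\<Delta> = "map lift_N (IsE (OVar 0) # map lift_O [?H])"
    have neg: "oderives (oid1 \<psi>) ?\<Delta> (ONeg (In (OVar 0) (Var 0)))"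
      by (rule stage_of_e) (use wf in simp_all)
    show "oderives (oid1 \<psi>) ?\<Delta> (OImp (In (OVar 0) (Var 0)) ?\<theta>)"
      by (rule consequence[OF neg neg]) (use wf in auto)
  qed
  have step: "oderives (oid1 \<psi>) [?H]
    (AllO (OImp (OCon (ONeg (IsE (OVar 0))) (AllN (at_child ?A))) ?A))"
  proof (rule oderives.AllOI, rule oderives.ImpI)
    let ?K = "OCon (ONeg (IsE (OVar 0))) (AllN (at_child ?A))"
    let ?\<Gamma> = "?K # map lift_O [?H]"
    let ?below = "AllN (OImp (below (OVar 0)) ?\<theta>)"
    have wf_K: "wf_oform ?K" using wf unfolding child by simp
    \<comment> \<open>The induction hypothesis, quantified over children and then over \<open>x\<close>, is \<open>I\<^bsub>\<prec>\<alpha>\<^esub> \<subseteq> \<theta>\<close>.\<close>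
    have "oderives (oid1 \<psi>) ?\<Gamma> ?below"
    proof (rule oderives.AllNI)
      let ?\<Delta> = "map lift_N ?\<Gamma>"
      show "oderives (oid1 \<psi>) ?\<Delta> (OImp (below (OVar 0)) ?\<theta>)"
        unfolding below_def
      proof (rule ExN_elim_imp)
        \<comment> \<open>The context has been lifted twice, for \<open>x\<close> (now 1) and for the child (now 0), so the two
          quantifiers of the induction hypothesis are instantiated with 0 and 1 in this order.\<close>
        let ?D = "OImp (In (Sub (OVar 0) (Var 1)) (Var 0)) (osubst (up shift) OVar ?\<theta>)"
        let ?D2 = "osubst (up (up shift)) OVar (osubst (up (up shift)) OVar ?D)"
        let ?D3 = "osubst (up (case_nat (Var 0) Var)) OVar ?D2"
        have "oderives (oid1 \<psi>) (map lift_N ?\<Delta>) (lift_N (lift_N (AllN (at_child ?A))))"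
          by (rule oderives.ConE2[of _ _ "ONeg (IsE (OVar 0))"]) (use wf wf_K in simp)
        then have "oderives (oid1 \<psi>) (map lift_N ?\<Delta>) (AllN (AllN ?D2))"
          by (simp only: child lift_\<theta> osubst.simps nup_OVar)
        from oderives.AllNE[OF this, of "Var 0"]
        have "oderives (oid1 \<psi>) (map lift_N ?\<Delta>) (AllN ?D3)"
          by (simp only: osubst.simps nup_OVar wf_trm.simps)
        from oderives.AllNE[OF this, of "Var 1"]
        have inst: "oderives (oid1 \<psi>) (map lift_N ?\<Delta>) (inst_N (Var 1) ?D3)" by simp
        have eq: "inst_N (Var 1) (osubst (up (case_nat (Var 0) Var)) OVar
            (osubst (up (up shift)) OVar (osubst (up (up shift)) OVar
              (osubst (up shift) OVar ?\<theta>)))) = lift_N ?\<theta>"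
          unfolding osubst_comp by (rule osubst_cong) (auto simp: up_def split: nat.splits)
        have "inst_N (Var 1) ?D3 =
          OImp (In (Sub (subst_otrm (\<lambda>n. Var (n + 2)) OVar (OVar 0)) (Var 0)) (Var 1)) (lift_N ?\<theta>)"
          unfolding osubst.simps eq by (simp add: up_def)
        then show "oderives (oid1 \<psi>) (map lift_N ?\<Delta>)
          (OImp (In (Sub (subst_otrm (\<lambda>n. Var (n + 2)) OVar (OVar 0)) (Var 0)) (Var 1))
             (lift_N ?\<theta>))"
          using inst by (simp only:)
      qed (use wf in simp)
    qed
    moreover have "oderives (oid1 \<psi>) (?below # ?\<Gamma>) ?A"
    proof (rule oderives.AllNI)
      let ?\<Delta> = "map lift_N (?below # ?\<Gamma>)"
      have "oderives (oid1 \<psi>) ?\<Delta> (OImp (plug (below (OVar 0)) \<psi>) (plug ?\<theta>' \<psi>))"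
        by (rule positive_mono[OF assms(3,1)]) (use wf wf_K in \<open>auto simp: osubst_hat\<close>)
      moreover have "oderives (oid1 \<psi>) ?\<Delta> (OImp (plug ?\<theta>' \<psi>) ?\<theta>)"
        by (rule AllN_hyp_Var) (use wf wf_K lift_H in simp_all)
      ultimately have 1: "oderives (oid1 \<psi>) ?\<Delta> (OImp (plug (below (OVar 0)) \<psi>) ?\<theta>)"
        by (rule imp_trans)
      have "oderives (oid1 \<psi>) ?\<Delta> (ONeg (IsE (OVar 0)))"
        by (rule oderives.ConE1[of _ _ _ "lift_N (AllN (at_child ?A))"]) (use wf wf_K in simp)
      from imp_trans[OF oderives.ConE1[OF stage_iff[OF assms(1,2) this]] 1]
      show "oderives (oid1 \<psi>) ?\<Delta> (OImp (In (OVar 0) (Var 0)) ?\<theta>)" .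
    qed
    ultimately show "oderives (oid1 \<psi>) ?\<Gamma> ?A" by (rule cut)
  qed
  have "oderives (oid1 \<psi>) [?H] (AllO ?A)"
    by (rule oderives.ImpE[OF oid1_axiom[OF oid1_axioms.tree_induction] oderives.ConI[OF base step]])
      (use wf wf_conclusion[OF step] in auto)
  moreover have "oderives (oid1 \<psi>) [] (OImp (AllO ?A) (AllN (OImp some_stage ?\<theta>)))"
  proof (rule oderives.ImpI, rule oderives.AllNI)
    let ?\<Gamma> = "map lift_N [AllO ?A]"
    have "oderives (oid1 \<psi>) (map lift_O ?\<Gamma>) (lift_N ?A)"
      by (rule AllO_hyp_Var) (use wf in simp_all)
    from AllN_elim_Var[OF this]
    have "oderives (oid1 \<psi>) (map lift_O ?\<Gamma>) (OImp (In (OVar 0) (Var 0)) (lift_O ?\<theta>))"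
      by (simp only: osubst_hat_O)
    then show "oderives (oid1 \<psi>) ?\<Gamma> (OImp some_stage ?\<theta>)"
      unfolding some_stage_def by (rule ExO_elim_imp) (use wf in simp)
  qed
  ultimately show "oderives (oid1 \<psi>) [?H] (AllN (OImp some_stage ?\<theta>))" by (rule apply_theorem)
qed

section \<open>Translating derivations\<close>

lemma hat_axiom_provable:
  assumes "wf_form \<psi>" "fv \<psi> \<subseteq> {0}" "positive \<psi>" "A \<in> id1_axioms \<psi>" "wf_form A"
  shows "oderives (oid1 \<psi>) [] (hat A)"
  using assms(4,5)
proof (induction rule: id1_axioms.induct)
  case (arith A)
  then show ?case by (intro oid1_axiom oid1_axioms.arith) auto
next
  case (induction A)
  have "hat (Imp (Con (inst zero A) (All (Imp A (subst (case_nat (suc (Var 0)) shift) A)))) (All A))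
    \<in> oid1_axioms \<psi>"
    using oid1_axioms.induction[of "hat A" \<psi>] induction by (simp add: osubst_hat)
  then show ?case using induction.prems by (intro oid1_axiom wf_hat) simp_all
next
  case closure
  then show ?case using closure_provable[OF assms(1-3)] by (simp add: hat_eq_plug[of \<psi>])
next
  case (least \<theta>)
  then show ?case using least_provable[OF assms(1-3)] by (simp add: hat_psubst)
qed

lemma hat_lift: "map hat (map lift \<Gamma>) = map lift_N (map hat \<Gamma>)"
  by (simp add: osubst_hat)

text \<open>
  As \<open>hat\<close> commutes with substitution (\<open>osubst_hat\<close>), each rule of the one-sorted calculus becomes the
  corresponding rule for the sort \<open>N\<close>.
\<close>

lemma derives_hat:
  assumes "wf_form \<psi>" "fv \<psi> \<subseteq> {0}" "positive \<psi>" "derives (id1_axioms \<psi>) \<Gamma> A"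
  shows "oderives (oid1 \<psi>) (map hat \<Gamma>) (hat A)"
  using assms(4)
proof (induction rule: derives.induct)
  case (Ax A \<Gamma>)
  show ?case
    by (rule from_theorem[OF hat_axiom_provable[OF assms(1-3) Ax(1,2)]]) (use Ax(3) in auto)
next
  case (Classical A \<Gamma> B)
  then show ?case by (intro oderives.Classical[of _ "hat A" _ "hat B"]) simp_all
next
  case (AllI \<Gamma> A)
  then show ?case by (auto intro: oderives.AllNI simp: hat_lift[symmetric] simp del: map_map)
next
  case (AllE \<Gamma> A t)
  then show ?case
    using oderives.AllNE[of _ _ "hat A" t] by (simp add: osubst_hat)
next
  case (ExI \<Gamma> t A)
  then show ?case by (auto intro!: oderives.ExNI[of _ _ t] simp: osubst_hat)
next
  case (ExE \<Gamma> A C)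
  have "oderives (oid1 \<psi>) (hat A # map lift_N (map hat \<Gamma>)) (lift_N (hat C))"
    using ExE.IH(2) unfolding hat_lift[symmetric] by (simp add: osubst_hat)
  with ExE.IH(1) show ?case using ExE.hyps by (auto intro: oderives.ExNE)
next
  case (EqSubst \<Gamma> s t A)
  then show ?case using oderives.EqSubst[of _ _ s t "hat A"] by (simp add: osubst_hat)
next
  case (ConE1 \<Gamma> A B)
  then show ?case using oderives.ConE1[of _ _ "hat A" "hat B"] by simp
next
  case (ConE2 \<Gamma> A B)
  then show ?case using oderives.ConE2[of _ _ "hat A" "hat B"] by simp
next
  case (ImpE \<Gamma> A B)
  then show ?case using oderives.ImpE[of _ _ "hat A" "hat B"] by simp
next
  case (NegI A \<Gamma> B)
  then show ?case using oderives.NegI[of _ "hat A" "map hat \<Gamma>" "hat B"] by simp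
next
  case (DisE \<Gamma> A B C)
  then show ?case using oderives.DisE[of _ _ "hat A" "hat B" "hat C"] by simp
next
  case (EqRefl t \<Gamma>)
  then show ?case by (simp add: oderives.EqRefl)
qed (auto intro: oderives.ConI oderives.DisI1 oderives.DisI2 oderives.ImpI)

theorem theorem3p1:
  fixes \<psi> \<phi> :: form
  assumes "wf_form \<psi>" and "fv \<psi> \<subseteq> {0}" and "positive \<psi>"
    and "id1_proves \<psi> \<phi>"
  shows "oid1_proves \<psi> (hat \<phi>)"
  using derives_hat[OF assms(1-3), of "[]" \<phi>] assms(4)
  by (simp add: id1_proves_def oid1_proves_def)

end
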